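(* Every aperiodic full semigraph algebra is cancelling.
   Context: Conventions. $k$ is an index set; $\mathbb{N}_0=\{0,1,2,\dots\}$; $\mathbb{Z}^k$ and $\mathbb{N}_0^k$ denote the finitely supported functions $k\to\mathbb{Z}$, $k\to\mathbb{N}_0$, with coordinatewise order, and $\vee$ is coordinatewise maximum. A $*$-algebra is an algebra over $\mathbb{C}$ with involution; a partial isometry is an element $s$ with $ss^*s=s$; a projection is $p$ with $p=p^2=p^*$; for projections, $q\le p$ means $qp=q$. Semigraphs. A semimultiplicative set is a set $T$ with a partially defined multiplication $(s,t)\mapsto st\in T$ (defined on a set $T^{(2)}$ of pairs) such that for all $s,t,u\in T$, $(st)u$ is defined (i.e. $st$ is defined and then $(st)u$ is defined) if and only if $s(tu)$ is defined, in which case both are equal. A $k$-semigraph is a semimultiplicative set $T$ with a map $d:T\to\mathbb{N}_0^k$ (the degree) such that (1) $d(xy)=d(x)+d(y)$ whenever $xy$ is defined; (2) for all $x\in T$ and $n_1,n_2\in\mathbb{N}_0^k$ with $d(x)=n_1+n_2$ there are unique $x_1,x_2\in T$ with $x=x_1x_2$, $d(x_1)=n_1$, $d(x_2)=n_2$. If $0\le n_1\le n_2\le d(x)$, then $x=x_1x_2x_3$ for unique $x_i\in T$ with $d(x_1)=n_1$, $d(x_2)=n_2-n_1$, $d(x_3)=d(x)-n_2$, and $x(n_1,n_2):=x_2$. $T^{(\min)}(x,y)=\{(\alpha,\beta)\in T\times T: x\alpha, y\beta \text{ are defined},\ x\alpha=y\beta,\ d(x\alpha)=d(x)\vee d(y)\}$;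 $T$ is finitely aligned if all these sets are finite. $T$ is a non-unital $k$-semigraph if $T=T_1\setminus\{1\}$ for a $k$-semigraph $T_1$ with unit $1$; it is called finitely aligned if $T_1$ is. Semigraph algebra. A ($k$-)semigraph algebra $X$ is a $*$-algebra generated by disjoint subsets $\mathcal{P},\mathcal{T}\subseteq X$ such that: (i) $\mathcal{P}$ is a set of commuting projections closed under multiplication; (ii) $\mathcal{T}$ is a set of nonzero partial isometries closed under nonzero products; (iii) $\mathcal{T}$ is a non-unital finitely aligned $k$-semigraph (the product of $s,t\in\mathcal{T}$ is defined in $\mathcal{T}$ iff $st\ne0$ in $X$, and is then $st$), with unitization $\mathcal{T}_1=\mathcal{T}\sqcup\{1\}$, where $1$ is identified with the unit of the unitization $X\oplus\mathbb{C}1$; (iv) for all $x\in\mathcal{T}$, $p\in\mathcal{P}$ there is $q\in\mathcal{P}$ with $px=xq$; (v) for all $x,y\in\mathcal{T}$ there are $q_{x,y,\alpha,\beta}\in\mathcal{P}$ with $x^*y=\sum_{(\alpha,\beta)\in\mathcal{T}_1^{(\min)}(x,y)}\alpha\, q_{x,y,\alpha,\beta}\,\beta^*$; (vi) $X$ is canonically the quotient of $\mathbb{F}$ by a subset of the fiber space of $\mathbb{F}$, i.e. the kernel of the canonical map $\mathbb{F}\to X$ is generated, as a two-sided self-adjoint ideal, by a subset of the fiber space. Here $\mathbb{F}$ is the free non-unital $*$-algebra on the letter set $\mathcal{T}\cup\mathcal{P}$ (with basis all nonempty formal words in letters $a$ and $a^*$); the degree $d(x_1\cdots x_n)=\sum_i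 d(x_i)\in\mathbb{Z}^k$ of a word is given by the semigraph degree on $\mathcal{T}$, $d(p)=0$ for $p\in\mathcal{P}$, $d(a^* )=-d(a)$; $\mathbb{F}_n$ is the span of words of degree $n$; the fiber space is $\bigcup_{n\in\mathbb{Z}^k}\mathbb{F}_n$. Further notions for $X$. A word of $X$ is the image of a word of $\mathbb{F}$; the degree map descends to a well-defined degree map $d$ on the nonzero words of $X$. A standard word is an element $spt^*$ with $s,t\in\mathcal{T}_1$, $p\in\mathcal{P}$; a half-standard word is an element $sp$ with $s\in\mathcal{T}_1$, $p\in\mathcal{P}$. Write $P_x=xx^*$. A standard projection is an element of $X$ of the form $P_x(1-P_{y_1})\cdots(1-P_{y_m})$ with $m\ge0$ and $x,y_1,\dots,y_m$ half-standard words. An elementary standard projection is an element of the form $p(1-p_1)\cdots(1-p_m)$ with $m\ge 0$ and $p,p_1,\dots,p_m\in\mathcal{P}$. Cancelling: $X$ is cancelling if for every standard word $w$ with nonzero degree and every nonzero standard projection $p$ there is a nonzero standard projection $q$ with $q\le p$ and $qwq=0$. Full: $\mathcal{T}_1^{(\infty)}$ is the set of functions $x:\mathbb{N}_0^k\to\mathcal{T}_1$, $n\mapsto x_n$, with $d(x_n)=n$ and $x_{n_2}(0,n_1)=x_{n_1}$ for all $n_1\le n_2$. $\mathcal{O}$ is the set of standard projections $p\in X$ such that for every $x\in\mathcal{T}_1^{(\infty)}$ there is some $n$ with $px_n=0$ (and hence $px_m=0$ for all $m\ge n$). $X_\|$ is the quotient of $X$ by the two-sided self-adjoint ideal generated by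 $\mathcal{O}$. $X$ is full if $X=X_\|$ (i.e. the quotient map is an isomorphism). Aperiodic: $X$ is aperiodic if for every elementary standard projection $e$, every $x\in\mathcal{T}$ with $xe\neq0$, and all distinct $m,n$ with $0\le m,n\le d(x)$, there exists $y\in\mathcal{T}_1$ such that $xey\ne0$ and $\mathcal{T}_1^{(\min)}\big((xy)(m,d(xy)),\,(xy)(n,d(xy))\big)=\emptyset$. *)

theory Defs
  imports Complex_Main "HOL.Hull" "HOL-Library.Poly_Mapping"
begin

section \<open>Complex star-algebras\<close>

class star =
  fixes star :: "'a \<Rightarrow> 'a"  (\<open>(_\<^sup>\<star>)\<close> [1000] 999)

class scaleC =
  fixes scaleC :: "complex \<Rightarrow> 'a \<Rightarrow> 'a"  (infixr \<open>*\<^sub>C\<close> 75)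

text \<open>The class \<open>ring\<close> does not require a unit, nor that the algebra be nonzero.\<close>

class star_algebra = ring + scaleC + star +
  assumes scaleC_add_right: "c *\<^sub>C (a + b) = c *\<^sub>C a + c *\<^sub>C b"
    and scaleC_add_left: "(c + e) *\<^sub>C a = c *\<^sub>C a + e *\<^sub>C a"
    and scaleC_scaleC: "c *\<^sub>C e *\<^sub>C a = (c * e) *\<^sub>C a"
    and scaleC_one: "1 *\<^sub>C a = a"
    and scaleC_mult_left: "(c *\<^sub>C a) * b = c *\<^sub>C (a * b)"
    and scaleC_mult_right: "a * (c *\<^sub>C b) = c *\<^sub>C (a * b)"
    and star_add: "(a + b)\<^sup>\<star> = a\<^sup>\<star> + b\<^sup>\<star>"
    and star_scaleC: "(c *\<^sub>C a)\<^sup>\<star> = cnj c *\<^sub>C a\<^sup>\<star>"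
    and star_mult: "(a * b)\<^sup>\<star> = b\<^sup>\<star> * a\<^sup>\<star>"
    and star_star: "(a\<^sup>\<star>)\<^sup>\<star> = a"
begin

lemma scaleC_zero_right [simp]: "c *\<^sub>C 0 = 0"
  using scaleC_add_right[of c 0 0] by simp

lemma scaleC_zero_left [simp]: "0 *\<^sub>C a = 0"
  using scaleC_add_left[of 0 0 a] by simp

lemma star_zero [simp]: "0\<^sup>\<star> = 0"
  using star_add[of 0 0] by simp

end

definition is_projection :: "'a::{times,star} \<Rightarrow> bool" where
  "is_projection p \<longleftrightarrow> p * p = p \<and> p\<^sup>\<star> = p"

definition partial_isometry :: "'a::{times,star} \<Rightarrow> bool" where
  "partial_isometry s \<longleftrightarrow> s * s\<^sup>\<star> * s = s"

definition star_subalgebra :: "'a::star_algebra set \<Rightarrow> bool" where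
  "star_subalgebra A \<longleftrightarrow> 0 \<in> A \<and>
     (\<forall>a\<in>A. \<forall>b\<in>A. a + b \<in> A \<and> a * b \<in> A) \<and>
     (\<forall>a\<in>A. a\<^sup>\<star> \<in> A \<and> (\<forall>c. c *\<^sub>C a \<in> A))"

text \<open>
  Two-sided self-adjoint ideals of a star-subalgebra \<open>A\<close>;
  \<open>star_ideal A hull R\<close> is the one generated by \<open>R \<subseteq> A\<close>.
\<close>

definition star_ideal :: "'a::star_algebra set \<Rightarrow> 'a set \<Rightarrow> bool" where
  "star_ideal A I \<longleftrightarrow> I \<subseteq> A \<and> 0 \<in> I \<and>
     (\<forall>a\<in>I. \<forall>b\<in>I. a + b \<in> I) \<and>
     (\<forall>a\<in>I. a\<^sup>\<star> \<in> I \<and> (\<forall>c. c *\<^sub>C a \<in> I)) \<and>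
     (\<forall>a\<in>I. \<forall>b\<in>A. a * b \<in> I \<and> b * a \<in> I)"

instantiation complex :: star_algebra
begin

definition scaleC_complex :: "complex \<Rightarrow> complex \<Rightarrow> complex" where
  "scaleC_complex c a = c * a"

definition star_complex :: "complex \<Rightarrow> complex" where
  "star_complex = cnj"

instance
  by standard (simp_all add: scaleC_complex_def star_complex_def algebra_simps)

end

subsection \<open>Unitization\<close>

datatype 'a unitization = Unitization (alg_part: 'a) (scalar_part: complex)

instantiation unitization :: (star_algebra) "{ring_1, star_algebra}"
begin

definition "0 = Unitization 0 0"
definition "1 = Unitization 0 1"
definition "x + y = Unitization (alg_part x + alg_part y) (scalar_part x + scalar_part y)"
definition "- x = Unitization (- alg_part x) (- scalar_part x)"
definition "x - y = Unitization (alg_part x - alg_part y) (scalar_part x - scalar_part y)"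
definition "x * y = Unitization
  (alg_part x * alg_part y + scalar_part x *\<^sub>C alg_part y + scalar_part y *\<^sub>C alg_part x)
  (scalar_part x * scalar_part y)"
definition "c *\<^sub>C x = Unitization (c *\<^sub>C alg_part x) (c * scalar_part x)"
definition "x\<^sup>\<star> = Unitization ((alg_part x)\<^sup>\<star>) (cnj (scalar_part x))"

instance
  by standard
    (auto simp: zero_unitization_def one_unitization_def plus_unitization_def
      uminus_unitization_def minus_unitization_def times_unitization_def
      scaleC_unitization_def star_unitization_def unitization.expand
      scaleC_add_right scaleC_add_left scaleC_scaleC scaleC_one scaleC_mult_left
      scaleC_mult_right star_add star_scaleC star_mult star_star algebra_simps)

end

definition embed :: "'a \<Rightarrow> 'a unitization" where
  "embed a = Unitization a 0"

section \<open>Degrees\<close>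

text \<open>
  Degrees are finitely supported functions \<open>'k \<Rightarrow>\<^sub>0 nat\<close> whose support is contained in the index
  set \<open>K\<close>. The library orders such functions lexicographically, so the coordinatewise order and
  maximum are introduced separately. Addition and the (truncated) subtraction of the library
  are coordinatewise.
\<close>

definition degs :: "'k set \<Rightarrow> ('k \<Rightarrow>\<^sub>0 nat) set" where
  "degs K = {n. Poly_Mapping.keys n \<subseteq> K}"

definition deg_le :: "('k \<Rightarrow>\<^sub>0 nat) \<Rightarrow> ('k \<Rightarrow>\<^sub>0 nat) \<Rightarrow> bool"  (infix \<open>\<preceq>\<close> 50) where
  "m \<preceq> n \<longleftrightarrow> (\<forall>i. Poly_Mapping.lookup m i \<le> Poly_Mapping.lookup n i)"

lift_definition deg_sup :: "('k \<Rightarrow>\<^sub>0 nat) \<Rightarrow> ('k \<Rightarrow>\<^sub>0 nat) \<Rightarrow> ('k \<Rightarrow>\<^sub>0 nat)"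
  is "\<lambda>m n i. max (m i) (n i)"
proof -
  fix m n :: "'k \<Rightarrow> nat"
  assume "finite {i. m i \<noteq> 0}" "finite {i. n i \<noteq> 0}"
  then have "finite ({i. m i \<noteq> 0} \<union> {i. n i \<noteq> 0})"
    by simp
  then show "finite {i. max (m i) (n i) \<noteq> 0}"
    by (rule rev_finite_subset) (auto simp: max_def)
qed

definition int_deg :: "('k \<Rightarrow>\<^sub>0 nat) \<Rightarrow> ('k \<Rightarrow>\<^sub>0 int)" where
  "int_deg n = Poly_Mapping.map int n"

section \<open>Semigraphs\<close>

text \<open>
  A partial multiplication is a function with values in \<open>option\<close>, \<open>None\<close> meaning undefined.
\<close>

locale semimultiplicative_set =
  fixes T :: "'s set" and mul :: "'s \<Rightarrow> 's \<Rightarrow> 's option"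
  assumes mul_closed: "s \<in> T \<Longrightarrow> t \<in> T \<Longrightarrow> mul s t = Some u \<Longrightarrow> u \<in> T"
    and mul_assoc: "s \<in> T \<Longrightarrow> t \<in> T \<Longrightarrow> u \<in> T \<Longrightarrow>
      Option.bind (mul s t) (\<lambda>a. mul a u) = Option.bind (mul t u) (\<lambda>b. mul s b)"

locale k_semigraph = semimultiplicative_set T mul
  for K :: "'k set" and T :: "'s set" and mul :: "'s \<Rightarrow> 's \<Rightarrow> 's option"
    and d :: "'s \<Rightarrow> 'k \<Rightarrow>\<^sub>0 nat" +
  assumes degree_in: "x \<in> T \<Longrightarrow> d x \<in> degs K"
    and degree_mul: "x \<in> T \<Longrightarrow> y \<in> T \<Longrightarrow> mul x y = Some z \<Longrightarrow> d z = d x + d y"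
    and factorization: "x \<in> T \<Longrightarrow> d x = n1 + n2 \<Longrightarrow>
      \<exists>!p. fst p \<in> T \<and> snd p \<in> T \<and> mul (fst p) (snd p) = Some x \<and>
           d (fst p) = n1 \<and> d (snd p) = n2"

locale unital_k_semigraph = k_semigraph K T mul d
  for K :: "'k set" and T :: "'s set" and mul :: "'s \<Rightarrow> 's \<Rightarrow> 's option"
    and d :: "'s \<Rightarrow> 'k \<Rightarrow>\<^sub>0 nat" and e :: 's +
  assumes unit_in: "e \<in> T"
    and unit_left: "x \<in> T \<Longrightarrow> mul e x = Some x"
    and unit_right: "x \<in> T \<Longrightarrow> mul x e = Some x"

text \<open>The element \<open>x(n1,n2)\<close>; only meaningful for \<open>n1 \<preceq> n2 \<preceq> d x\<close>.\<close>

definition segment ::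
  "'s set \<Rightarrow> ('s \<Rightarrow> 's \<Rightarrow> 's option) \<Rightarrow> ('s \<Rightarrow> 'k \<Rightarrow>\<^sub>0 nat) \<Rightarrow> 's \<Rightarrow> ('k \<Rightarrow>\<^sub>0 nat) \<Rightarrow> ('k \<Rightarrow>\<^sub>0 nat) \<Rightarrow> 's"
  where
  "segment T mul d x n1 n2 =
    (THE x2. x2 \<in> T \<and> (\<exists>x1\<in>T. \<exists>x3\<in>T. Option.bind (mul x1 x2) (\<lambda>y. mul y x3) = Some x \<and>
       d x1 = n1 \<and> d x2 = n2 - n1 \<and> d x3 = d x - n2))"

definition Tmin ::
  "'s set \<Rightarrow> ('s \<Rightarrow> 's \<Rightarrow> 's option) \<Rightarrow> ('s \<Rightarrow> 'k \<Rightarrow>\<^sub>0 nat) \<Rightarrow> 's \<Rightarrow> 's \<Rightarrow> ('s \<times> 's) set" where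
  "Tmin T mul d x y = {(\<alpha>, \<beta>). \<alpha> \<in> T \<and> \<beta> \<in> T \<and>
     (\<exists>z. mul x \<alpha> = Some z \<and> mul y \<beta> = Some z \<and> d z = deg_sup (d x) (d y))}"

definition finitely_aligned ::
  "'s set \<Rightarrow> ('s \<Rightarrow> 's \<Rightarrow> 's option) \<Rightarrow> ('s \<Rightarrow> 'k \<Rightarrow>\<^sub>0 nat) \<Rightarrow> bool" where
  "finitely_aligned T mul d \<longleftrightarrow> (\<forall>x\<in>T. \<forall>y\<in>T. finite (Tmin T mul d x y))"

section \<open>The free star-algebra\<close>

text \<open>
  A word is a list of formal letters \<open>a\<close> and \<open>a\<^sup>\<star>\<close>. Words form a monoid under concatenation
  (written additively, as required by the library type of finitely supported functions), and
  \<open>'a word \<Rightarrow>\<^sub>0 complex\<close> with the convolution product of the library is the free unital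
  algebra. The free non-unital star-algebra on a letter set \<open>L\<close> is the star-subalgebra
  \<open>free_alg L\<close> below.
\<close>

datatype 'a letter = Gen 'a | Gen_star 'a

datatype 'a word = Word (word_letters: "'a letter list")

fun letter_star :: "'a letter \<Rightarrow> 'a letter" where
  "letter_star (Gen a) = Gen_star a"
| "letter_star (Gen_star a) = Gen a"

class star_monoid_add = monoid_add + star +
  assumes star_plus_rev: "(a + b)\<^sup>\<star> = b\<^sup>\<star> + a\<^sup>\<star>"
    and star_invol: "(a\<^sup>\<star>)\<^sup>\<star> = a"

instantiation word :: (type) star_monoid_add
begin

definition "0 = Word []"
definition "v + w = Word (word_letters v @ word_letters w)"
definition "w\<^sup>\<star> = Word (rev (map letter_star (word_letters w)))"

instance
proof
  have ll: "letter_star (letter_star x) = x" for x :: "'a letter"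
    by (cases x) auto
  show "(a\<^sup>\<star>)\<^sup>\<star> = a" for a :: "'a word"
    by (cases a) (simp add: star_word_def rev_map o_def ll)
qed (auto simp: zero_word_def plus_word_def star_word_def)

end

lemma poly_mapping_sum_single:
  "(\<Sum>w\<in>Poly_Mapping.keys f. Poly_Mapping.single w (Poly_Mapping.lookup f w)) = f"
  by (rule poly_mapping_eqI)
    (auto simp: lookup_sum lookup_single when_def sum.delta in_keys_iff)

instantiation poly_mapping :: (star_monoid_add, star_algebra) star_algebra
begin

lift_definition scaleC_poly_mapping :: "complex \<Rightarrow> ('a \<Rightarrow>\<^sub>0 'b) \<Rightarrow> 'a \<Rightarrow>\<^sub>0 'b"
  is "\<lambda>c f w. c *\<^sub>C f w"
  by (rule rev_finite_subset, assumption) auto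

lift_definition star_poly_mapping :: "('a \<Rightarrow>\<^sub>0 'b) \<Rightarrow> 'a \<Rightarrow>\<^sub>0 'b"
  is "\<lambda>f w. (f (w\<^sup>\<star>))\<^sup>\<star>"
proof -
  fix f :: "'a \<Rightarrow> 'b"
  assume "finite {w. f w \<noteq> 0}"
  then have "finite (star ` {w. f w \<noteq> 0})"
    by simp
  moreover have "{w. (f (w\<^sup>\<star>))\<^sup>\<star> \<noteq> 0} \<subseteq> star ` {w. f w \<noteq> 0}"
    by (force intro: image_eqI[of _ _ "_\<^sup>\<star>"] simp: star_invol)
  ultimately show "finite {w. (f (w\<^sup>\<star>))\<^sup>\<star> \<noteq> 0}"
    by (rule rev_finite_subset)
qed


instance
proof
  fix c e :: complex and a b :: "'a \<Rightarrow>\<^sub>0 'b"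
  have single_star: "(Poly_Mapping.single w x)\<^sup>\<star> = Poly_Mapping.single (w\<^sup>\<star>) (x\<^sup>\<star>)"
    for w :: 'a and x :: 'b
    by transfer (auto simp: fun_eq_iff when_def star_invol)
  have single_scale: "c *\<^sub>C Poly_Mapping.single w x = Poly_Mapping.single w (c *\<^sub>C x)"
    for c and w :: 'a and x :: 'b
    by transfer (auto simp: fun_eq_iff when_def)
  have star_plus: "(f + g)\<^sup>\<star> = f\<^sup>\<star> + g\<^sup>\<star>" for f g :: "'a \<Rightarrow>\<^sub>0 'b"
    by transfer (simp add: star_add)
  have scale_plus: "c *\<^sub>C (f + g) = c *\<^sub>C f + c *\<^sub>C g" for c and f g :: "'a \<Rightarrow>\<^sub>0 'b"
    by transfer (simp add: scaleC_add_right)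
  have star_0: "0\<^sup>\<star> = (0 :: 'a \<Rightarrow>\<^sub>0 'b)"
    by transfer simp
  have scale_0: "c *\<^sub>C 0 = (0 :: 'a \<Rightarrow>\<^sub>0 'b)" for c
    by transfer simp
  have star_sum: "(\<Sum>i\<in>I. h i)\<^sup>\<star> = (\<Sum>i\<in>I. (h i)\<^sup>\<star>)" for I :: "'i set" and h :: "'i \<Rightarrow> 'a \<Rightarrow>\<^sub>0 'b"
    by (induction I rule: infinite_finite_induct) (simp_all add: star_plus star_0)
  have scale_sum: "c *\<^sub>C (\<Sum>i\<in>I. h i) = (\<Sum>i\<in>I. c *\<^sub>C h i)"
    for c and I :: "'i set" and h :: "'i \<Rightarrow> 'a \<Rightarrow>\<^sub>0 'b"
    by (induction I rule: infinite_finite_induct) (simp_all add: scale_plus scale_0)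
  obtain A x where a: "a = (\<Sum>w\<in>A. Poly_Mapping.single w (x w))"
    by (rule that, rule poly_mapping_sum_single[symmetric])
  obtain B y where b: "b = (\<Sum>w\<in>B. Poly_Mapping.single w (y w))"
    by (rule that, rule poly_mapping_sum_single[symmetric])
  show "c *\<^sub>C (a + b) = c *\<^sub>C a + c *\<^sub>C b"
    by (fact scale_plus)
  show "(c + e) *\<^sub>C a = c *\<^sub>C a + e *\<^sub>C a"
    by transfer (simp add: scaleC_add_left)
  show "c *\<^sub>C e *\<^sub>C a = (c * e) *\<^sub>C a"
    by transfer (simp add: scaleC_scaleC)
  show "1 *\<^sub>C a = a"
    by transfer (simp add: scaleC_one)
  show "(c *\<^sub>C a) * b = c *\<^sub>C (a * b)"
    unfolding a b by (simp add: sum_product scale_sum single_scale mult_single scaleC_mult_left)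
  show "a * (c *\<^sub>C b) = c *\<^sub>C (a * b)"
    unfolding a b by (simp add: sum_product scale_sum single_scale mult_single scaleC_mult_right)
  show "(a + b)\<^sup>\<star> = a\<^sup>\<star> + b\<^sup>\<star>"
    by (fact star_plus)
  show "(c *\<^sub>C a)\<^sup>\<star> = cnj c *\<^sub>C a\<^sup>\<star>"
    by transfer (simp add: star_scaleC)
  show "(a * b)\<^sup>\<star> = b\<^sup>\<star> * a\<^sup>\<star>"
    unfolding a b
    by (simp add: sum_product star_sum single_star mult_single star_mult star_plus_rev sum.swap[of _ B A])
  show "(a\<^sup>\<star>)\<^sup>\<star> = a"
    by transfer (simp add: star_star star_invol)
qed

end

text \<open>The letters and their formal adjoints are taken from \<open>L\<close>; the empty word is excluded.\<close>

definition words :: "'a set \<Rightarrow> 'a word set" where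
  "words L = {w. w \<noteq> 0 \<and> set_word w \<subseteq> L}"

definition free_alg :: "'a set \<Rightarrow> ('a word \<Rightarrow>\<^sub>0 complex) set" where
  "free_alg L = {f. Poly_Mapping.keys f \<subseteq> words L}"

fun letter_val :: "'a::star_algebra letter \<Rightarrow> 'a" where
  "letter_val (Gen a) = a"
| "letter_val (Gen_star a) = a\<^sup>\<star>"

text \<open>
  The product of the letters of a nonempty word, computed in the unitization so that the
  library product of lists applies; the result lies in the algebra itself.
\<close>

definition word_val :: "'a::star_algebra word \<Rightarrow> 'a" where
  "word_val w = alg_part (prod_list (map (\<lambda>l. embed (letter_val l)) (word_letters w)))"

definition canonical_map :: "('a::star_algebra word \<Rightarrow>\<^sub>0 complex) \<Rightarrow> 'a" where
  "canonical_map f = (\<Sum>w\<in>Poly_Mapping.keys f. Poly_Mapping.lookup f w *\<^sub>C word_val w)"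

text \<open>Letters outside \<open>T\<close> (that is, the projections) have degree zero.\<close>

definition gen_deg :: "'a set \<Rightarrow> ('a \<Rightarrow> 'k \<Rightarrow>\<^sub>0 nat) \<Rightarrow> 'a \<Rightarrow> 'k \<Rightarrow>\<^sub>0 int" where
  "gen_deg T d a = (if a \<in> T then int_deg (d a) else 0)"

fun letter_deg :: "'a set \<Rightarrow> ('a \<Rightarrow> 'k \<Rightarrow>\<^sub>0 nat) \<Rightarrow> 'a letter \<Rightarrow> 'k \<Rightarrow>\<^sub>0 int" where
  "letter_deg T d (Gen a) = gen_deg T d a"
| "letter_deg T d (Gen_star a) = - gen_deg T d a"

definition word_deg :: "'a set \<Rightarrow> ('a \<Rightarrow> 'k \<Rightarrow>\<^sub>0 nat) \<Rightarrow> 'a word \<Rightarrow> 'k \<Rightarrow>\<^sub>0 int" where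
  "word_deg T d w = (\<Sum>l\<leftarrow>word_letters w. letter_deg T d l)"

definition homogeneous ::
  "'a set \<Rightarrow> 'a set \<Rightarrow> ('a \<Rightarrow> 'k \<Rightarrow>\<^sub>0 nat) \<Rightarrow> ('k \<Rightarrow>\<^sub>0 int) \<Rightarrow> ('a word \<Rightarrow>\<^sub>0 complex) set" where
  "homogeneous P T d n = {f \<in> free_alg (T \<union> P). \<forall>w\<in>Poly_Mapping.keys f. word_deg T d w = n}"

definition fiber_space ::
  "'a set \<Rightarrow> 'a set \<Rightarrow> ('a \<Rightarrow> 'k \<Rightarrow>\<^sub>0 nat) \<Rightarrow> ('a word \<Rightarrow>\<^sub>0 complex) set" where
  "fiber_space P T d = (\<Union>n. homogeneous P T d n)"

section \<open>Semigraph algebras\<close>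

text \<open>
  The unitization \<open>T \<squnion> {1}\<close> of the semigraph, as a subset of the unitization of the algebra,
  with its partial multiplication (a product is defined iff it is nonzero) and its degree.
\<close>

definition T1 :: "'a::star_algebra set \<Rightarrow> 'a unitization set" where
  "T1 T = insert 1 (embed ` T)"

definition mul1 :: "'a::star_algebra unitization \<Rightarrow> 'a unitization \<Rightarrow> 'a unitization option" where
  "mul1 s t = (if s * t = 0 then None else Some (s * t))"

definition deg1 :: "('a::star_algebra \<Rightarrow> 'k \<Rightarrow>\<^sub>0 nat) \<Rightarrow> 'a unitization \<Rightarrow> 'k \<Rightarrow>\<^sub>0 nat" where
  "deg1 d x = (if x = 1 then 0 else d (alg_part x))"

abbreviation T1min ::
  "'a::star_algebra set \<Rightarrow> ('a \<Rightarrow> 'k \<Rightarrow>\<^sub>0 nat) \<Rightarrow> 'a unitization \<Rightarrow> 'a unitization \<Rightarrow>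
    ('a unitization \<times> 'a unitization) set" where
  "T1min T d \<equiv> Tmin (T1 T) mul1 (deg1 d)"

abbreviation segment1 ::
  "'a::star_algebra set \<Rightarrow> ('a \<Rightarrow> 'k \<Rightarrow>\<^sub>0 nat) \<Rightarrow>
    'a unitization \<Rightarrow> ('k \<Rightarrow>\<^sub>0 nat) \<Rightarrow> ('k \<Rightarrow>\<^sub>0 nat) \<Rightarrow> 'a unitization" where
  "segment1 T d \<equiv> segment (T1 T) mul1 (deg1 d)"

locale semigraph_algebra =
  fixes K :: "'k set" and P T :: "'a::star_algebra set" and d :: "'a \<Rightarrow> 'k \<Rightarrow>\<^sub>0 nat"
  assumes disjoint: "P \<inter> T = {}"
    and generated: "star_subalgebra hull (P \<union> T) = UNIV"
    and P_projection: "p \<in> P \<Longrightarrow> is_projection p"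
    and P_commute: "p \<in> P \<Longrightarrow> q \<in> P \<Longrightarrow> p * q = q * p"
    and P_mult: "p \<in> P \<Longrightarrow> q \<in> P \<Longrightarrow> p * q \<in> P"
    and T_partial_isometry: "s \<in> T \<Longrightarrow> s \<noteq> 0 \<and> partial_isometry s"
    and T_mult: "s \<in> T \<Longrightarrow> t \<in> T \<Longrightarrow> s * t \<noteq> 0 \<Longrightarrow> s * t \<in> T"
    and T_semigraph: "unital_k_semigraph K (T1 T) mul1 (deg1 d) 1"
    and T_finitely_aligned: "finitely_aligned (T1 T) mul1 (deg1 d)"
    and PT_commute: "x \<in> T \<Longrightarrow> p \<in> P \<Longrightarrow> \<exists>q\<in>P. p * x = x * q"
    and star_mult_expand: "x \<in> T \<Longrightarrow> y \<in> T \<Longrightarrow>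
      \<exists>q. (\<forall>(\<alpha>, \<beta>) \<in> T1min T d (embed x) (embed y). q \<alpha> \<beta> \<in> P) \<and>
          embed (x\<^sup>\<star> * y) = (\<Sum>(\<alpha>, \<beta>) \<in> T1min T d (embed x) (embed y). \<alpha> * embed (q \<alpha> \<beta>) * \<beta>\<^sup>\<star>)"
    and kernel_generated: "\<exists>R \<subseteq> fiber_space P T d.
      {f \<in> free_alg (T \<union> P). canonical_map f = 0} = star_ideal (free_alg (T \<union> P)) hull R"

text \<open>
  The degree of a nonzero word of the algebra is the degree of any word of the free algebra
  representing it; lemma \<open>degree_of_word_val\<close> below shows that it does not depend on the choice.
\<close>

definition degree_of ::
  "'a::star_algebra set \<Rightarrow> 'a set \<Rightarrow> ('a \<Rightarrow> 'k \<Rightarrow>\<^sub>0 nat) \<Rightarrow> 'a \<Rightarrow> 'k \<Rightarrow>\<^sub>0 int" where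
  "degree_of P T d x = (THE n. \<exists>w\<in>words (T \<union> P). word_val w = x \<and> word_deg T d w = n)"

lift_definition word_part :: "('a word \<Rightarrow> bool) \<Rightarrow> ('a word \<Rightarrow>\<^sub>0 complex) \<Rightarrow> 'a word \<Rightarrow>\<^sub>0 complex"
  is "\<lambda>Q f w. f w when Q w"
  by (rule rev_finite_subset, assumption) auto

lemma word_part_zero: "word_part Q 0 = 0"
  by transfer auto

lemma word_part_add: "word_part Q (f + g) = word_part Q f + word_part Q g"
  by transfer (auto simp: when_def)

lemma word_part_scaleC: "word_part Q (c *\<^sub>C f) = c *\<^sub>C word_part Q f"
  by transfer (auto simp: when_def)

lemma word_part_star: "word_part Q (f\<^sup>\<star>) = (word_part (\<lambda>w. Q (w\<^sup>\<star>)) f)\<^sup>\<star>"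
  by transfer (auto simp: when_def star_invol)

lemma word_part_single:
  "word_part Q (Poly_Mapping.single w c) = (if Q w then Poly_Mapping.single w c else 0)"
  by transfer (auto simp: when_def fun_eq_iff)

lemma word_part_sum: "word_part Q (\<Sum>i\<in>I. h i) = (\<Sum>i\<in>I. word_part Q (h i))"
  by (induction I rule: infinite_finite_induct) (simp_all add: word_part_add word_part_zero)

lemma lookup_word_part: "Poly_Mapping.lookup (word_part Q f) w = (Poly_Mapping.lookup f w when Q w)"
  by transfer simp

lemma word_deg_add: "word_deg T d (v + w) = word_deg T d v + word_deg T d w"
  by (simp add: word_deg_def plus_word_def)

lemma word_deg_star: "word_deg T d (w\<^sup>\<star>) = - word_deg T d w"
proof -
  have "letter_deg T d (letter_star l) = - letter_deg T d l" for l
    by (cases l) auto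
  then have "(\<Sum>l\<leftarrow>map letter_star xs. letter_deg T d l) = - (\<Sum>l\<leftarrow>xs. letter_deg T d l)" for xs
    by (induction xs) auto
  then show ?thesis
    by (simp add: word_deg_def star_word_def rev_map[symmetric] sum_list_rev flip: map_map rev_map)
qed

lemma word_part_mult_left:
  "word_part (\<lambda>v. word_deg T d v = n) (Poly_Mapping.single w c * f) =
   Poly_Mapping.single w c * word_part (\<lambda>v. word_deg T d v = n - word_deg T d w) f"
proof -
  obtain A x where f: "f = (\<Sum>v\<in>A. Poly_Mapping.single v (x v))"
    by (rule that, rule poly_mapping_sum_single[symmetric])
  show ?thesis
    unfolding f
    by (auto simp: sum_distrib_left word_part_sum mult_single word_part_single word_deg_add
        intro!: sum.cong)
qed

lemma word_part_mult_right:
  "word_part (\<lambda>v. word_deg T d v = n) (f * Poly_Mapping.single w c) =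
   word_part (\<lambda>v. word_deg T d v = n - word_deg T d w) f * Poly_Mapping.single w c"
proof -
  obtain A x where f: "f = (\<Sum>v\<in>A. Poly_Mapping.single v (x v))"
    by (rule that, rule poly_mapping_sum_single[symmetric])
  show ?thesis
    unfolding f
    by (auto simp: sum_distrib_right word_part_sum mult_single word_part_single word_deg_add
        intro!: sum.cong)
qed

lemma words_add: "v \<in> words L \<Longrightarrow> w \<in> words L \<Longrightarrow> v + w \<in> words L"
  by (cases v; cases w) (auto simp: words_def plus_word_def zero_word_def)

lemma words_star: "w \<in> words L \<Longrightarrow> w\<^sup>\<star> \<in> words L"
proof -
  have "set_letter (letter_star l) = set_letter l" for l :: "'a letter"
    by (cases l) auto
  then show "w \<in> words L \<Longrightarrow> w\<^sup>\<star> \<in> words L"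
    by (cases w) (auto simp: words_def star_word_def zero_word_def)
qed

lemma star_ideal_free_alg: "star_ideal (free_alg L) (free_alg L)"
proof -
  have add: "f + g \<in> free_alg L" if "f \<in> free_alg L" "g \<in> free_alg L" for f g
    using that Poly_Mapping.keys_add[of f g] by (auto simp: free_alg_def)
  have mult: "f * g \<in> free_alg L" if "f \<in> free_alg L" "g \<in> free_alg L" for f g
    using that keys_mult[of f g] words_add[of _ L] unfolding free_alg_def by blast
  have scale: "c *\<^sub>C f \<in> free_alg L" if "f \<in> free_alg L" for c f
  proof -
    have "Poly_Mapping.keys (c *\<^sub>C f) \<subseteq> Poly_Mapping.keys f"
      by transfer auto
    then show ?thesis
      using that by (auto simp: free_alg_def)
  qed
  have star: "f\<^sup>\<star> \<in> free_alg L" if "f \<in> free_alg L" for f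
  proof -
    have "w\<^sup>\<star> \<in> Poly_Mapping.keys f" if "w \<in> Poly_Mapping.keys (f\<^sup>\<star>)" for w
      using that by transfer auto
    then show ?thesis
      using that words_star unfolding free_alg_def by (metis mem_Collect_eq star_invol subset_iff)
  qed
  show ?thesis
    unfolding star_ideal_def using add mult scale star by (auto simp: free_alg_def)
qed

lemma star_ideal_hull:
  assumes "R \<subseteq> A" "star_ideal A A"
  shows "star_ideal A (star_ideal A hull R)"
proof -
  have "star_ideal A hull R \<subseteq> A"
    using assms by (intro hull_minimal)
  then show ?thesis
    unfolding star_ideal_def[of A "star_ideal A hull R"]
    by (auto simp: hull_def) (auto simp: star_ideal_def)
qed

lemma word_part_in_hull:
  assumes R: "R \<subseteq> fiber_space P T d"
    and f: "f \<in> star_ideal (free_alg (T \<union> P)) hull R"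
  shows "word_part (\<lambda>w. word_deg T d w = n) f \<in> star_ideal (free_alg (T \<union> P)) hull R"
proof -
  let ?F = "free_alg (T \<union> P)"
  define I where "I = star_ideal ?F hull R"
  define J where "J = {f \<in> ?F. \<forall>n. word_part (\<lambda>w. word_deg T d w = n) f \<in> I}"
  have RF: "R \<subseteq> ?F"
    using R by (auto simp: fiber_space_def homogeneous_def)
  have F: "star_ideal ?F ?F"
    by (rule star_ideal_free_alg)
  have I: "star_ideal ?F I"
    unfolding I_def by (rule star_ideal_hull[OF RF F])
  have I_add: "f + g \<in> I" if "f \<in> I" "g \<in> I" for f g
    using I that unfolding star_ideal_def by blast
  have I_star: "f\<^sup>\<star> \<in> I" and I_scale: "c *\<^sub>C f \<in> I" if "f \<in> I" for f c
    using I that unfolding star_ideal_def by blast+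
  have I_mult: "f * g \<in> I" "g * f \<in> I" if "f \<in> I" "g \<in> ?F" for f g
    using I that unfolding star_ideal_def by blast+
  have zero: "0 \<in> I"
    using I unfolding star_ideal_def by blast
  have F_add: "f + g \<in> ?F" and F_mult: "f * g \<in> ?F" if "f \<in> ?F" "g \<in> ?F" for f g
    using F that unfolding star_ideal_def by blast+
  have F_star: "f\<^sup>\<star> \<in> ?F" and F_scale: "c *\<^sub>C f \<in> ?F" if "f \<in> ?F" for f c
    using F that unfolding star_ideal_def by blast+
  have I_sum: "(\<Sum>i\<in>A. h i) \<in> I" if "\<And>i. i \<in> A \<Longrightarrow> h i \<in> I" for A :: "'a word set" and h
    using that by (induction A rule: infinite_finite_induct) (simp_all add: zero I_add)
  have single: "Poly_Mapping.single w c \<in> ?F" if "w \<in> words (T \<union> P)" for w c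
    using that by (simp add: free_alg_def)
  have "R \<subseteq> J"
  proof
    fix r assume r: "r \<in> R"
    obtain m where m: "\<And>w. w \<in> Poly_Mapping.keys r \<Longrightarrow> word_deg T d w = m"
      using subsetD[OF R r] by (auto simp: fiber_space_def homogeneous_def)
    have "word_part (\<lambda>w. word_deg T d w = n) r = (if n = m then r else 0)" for n
      using m by (intro poly_mapping_eqI) (auto simp: lookup_word_part when_def in_keys_iff)
    moreover have "r \<in> I"
      unfolding I_def using r by (rule hull_inc)
    ultimately show "r \<in> J"
      using r RF zero by (auto simp: J_def)
  qed
  moreover have "star_ideal ?F J"
    unfolding star_ideal_def[of ?F J]
  proof (intro conjI ballI allI)
    show "J \<subseteq> ?F" and "0 \<in> J"
      using zero by (auto simp: J_def word_part_zero free_alg_def)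
    show "f + g \<in> J" if "f \<in> J" "g \<in> J" for f g
      using that by (simp add: J_def word_part_add I_add F_add)
    show "c *\<^sub>C f \<in> J" if "f \<in> J" for c f
      using that I_scale F_scale by (auto simp: J_def word_part_scaleC)
    show "f\<^sup>\<star> \<in> J" if "f \<in> J" for f
    proof -
      have eq: "(word_deg T d (w\<^sup>\<star>) = n) = (word_deg T d w = - n)" for w n
        by (auto simp: word_deg_star)
      show ?thesis
        using that I_star F_star by (auto simp: J_def word_part_star eq)
    qed
    fix f g assume f: "f \<in> J" and g: "g \<in> ?F"
    have g_eq: "g = (\<Sum>w\<in>Poly_Mapping.keys g. Poly_Mapping.single w (Poly_Mapping.lookup g w))"
      by (rule poly_mapping_sum_single[symmetric])
    have keys: "w \<in> words (T \<union> P)" if "w \<in> Poly_Mapping.keys g" for w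
      using that g by (auto simp: free_alg_def)
    have "word_part (\<lambda>w. word_deg T d w = n) (f * g) \<in> I" for n
      by (subst g_eq, unfold sum_distrib_left word_part_sum word_part_mult_right, rule I_sum)
        (use f single keys in \<open>simp add: J_def I_mult\<close>)
    moreover have "word_part (\<lambda>w. word_deg T d w = n) (g * f) \<in> I" for n
      by (subst g_eq, unfold sum_distrib_right word_part_sum word_part_mult_left, rule I_sum)
        (use f single keys in \<open>simp add: J_def I_mult\<close>)
    ultimately show "f * g \<in> J" and "g * f \<in> J"
      using f g by (simp_all add: J_def F_mult)
  qed
  ultimately have "I \<subseteq> J"
    unfolding I_def by (rule hull_minimal)
  then show ?thesis
    using f by (auto simp: J_def I_def)
qed

lemma canonical_map_single: "canonical_map (Poly_Mapping.single w c) = c *\<^sub>C word_val w"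
  by (cases "c = 0") (auto simp: canonical_map_def)

lemma (in semigraph_algebra) degree_of_word_val:
  assumes w: "w \<in> words (T \<union> P)" and nz: "word_val w \<noteq> 0"
  shows "degree_of P T d (word_val w) = word_deg T d w"
proof -
  have "word_deg T d v = word_deg T d w"
    if v: "v \<in> words (T \<union> P)" and eq: "word_val v = word_val w" for v
  proof (rule ccontr)
    assume ne: "word_deg T d v \<noteq> word_deg T d w"
    then have "v \<noteq> w"
      by auto
    let ?f = "Poly_Mapping.single w 1 + Poly_Mapping.single v (- 1 :: complex)"
    obtain R where R: "R \<subseteq> fiber_space P T d"
      and ker: "{f \<in> free_alg (T \<union> P). canonical_map f = 0} = star_ideal (free_alg (T \<union> P)) hull R"
      using kernel_generated by blast
    have keys: "Poly_Mapping.keys ?f = {w, v}"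
      using \<open>v \<noteq> w\<close> by (auto simp: in_keys_iff lookup_add lookup_single when_def split: if_splits)
    have "1 *\<^sub>C word_val w + (- 1) *\<^sub>C word_val w = 0"
      using scaleC_add_left[of 1 "- 1" "word_val w"] by simp
    then have "canonical_map ?f = 0"
      using \<open>v \<noteq> w\<close> eq unfolding canonical_map_def keys
      by (simp add: lookup_add lookup_single when_def)
    moreover have "?f \<in> free_alg (T \<union> P)"
      using v w keys by (auto simp: free_alg_def)
    ultimately have "?f \<in> star_ideal (free_alg (T \<union> P)) hull R"
      using ker by blast
    then have "word_part (\<lambda>u. word_deg T d u = word_deg T d w) ?f \<in> star_ideal (free_alg (T \<union> P)) hull R"
      by (rule word_part_in_hull[OF R])
    then have "canonical_map (Poly_Mapping.single w 1) = 0"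
      using ker ne by (auto simp: word_part_add word_part_single)
    then show False
      using nz by (simp add: canonical_map_single scaleC_one)
  qed
  then show ?thesis
    unfolding degree_of_def using w by (intro the_equality) metis+
qed

definition standard_words :: "'a::star_algebra set \<Rightarrow> 'a set \<Rightarrow> 'a set" where
  "standard_words P T = {w. \<exists>s\<in>T1 T. \<exists>p\<in>P. \<exists>t\<in>T1 T. embed w = s * embed p * t\<^sup>\<star>}"

definition half_standard_words :: "'a::star_algebra set \<Rightarrow> 'a set \<Rightarrow> 'a set" where
  "half_standard_words P T = {w. \<exists>s\<in>T1 T. \<exists>p\<in>P. embed w = s * embed p}"

definition range_proj :: "'a::star_algebra \<Rightarrow> 'a" where
  "range_proj x = x * x\<^sup>\<star>"

definition standard_projections :: "'a::star_algebra set \<Rightarrow> 'a set \<Rightarrow> 'a set" where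
  "standard_projections P T = {e. \<exists>x ys. x \<in> half_standard_words P T \<and>
     set ys \<subseteq> half_standard_words P T \<and>
     embed e = embed (range_proj x) * (\<Prod>y\<leftarrow>ys. 1 - embed (range_proj y))}"

definition elementary_standard_projections :: "'a::star_algebra set \<Rightarrow> 'a set" where
  "elementary_standard_projections P = {e. \<exists>p ps. p \<in> P \<and> set ps \<subseteq> P \<and>
     embed e = embed p * (\<Prod>q\<leftarrow>ps. 1 - embed q)}"

subsection \<open>Cancelling, full and aperiodic semigraph algebras\<close>

definition cancelling ::
  "'a::star_algebra set \<Rightarrow> 'a set \<Rightarrow> ('a \<Rightarrow> 'k \<Rightarrow>\<^sub>0 nat) \<Rightarrow> bool" where
  "cancelling P T d \<longleftrightarrow>
    (\<forall>w\<in>standard_words P T. w \<noteq> 0 \<and> degree_of P T d w \<noteq> 0 \<longrightarrow>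
      (\<forall>p\<in>standard_projections P T. p \<noteq> 0 \<longrightarrow>
        (\<exists>q\<in>standard_projections P T. q \<noteq> 0 \<and> q * p = q \<and> q * w * q = 0)))"

definition infinite_paths ::
  "'k set \<Rightarrow> 'a::star_algebra set \<Rightarrow> ('a \<Rightarrow> 'k \<Rightarrow>\<^sub>0 nat) \<Rightarrow> (('k \<Rightarrow>\<^sub>0 nat) \<Rightarrow> 'a unitization) set" where
  "infinite_paths K T d = {x.
     (\<forall>n\<in>degs K. x n \<in> T1 T \<and> deg1 d (x n) = n) \<and>
     (\<forall>n1\<in>degs K. \<forall>n2\<in>degs K. n1 \<preceq> n2 \<longrightarrow> segment1 T d (x n2) 0 n1 = x n1)}"

definition vanishing_projections ::
  "'k set \<Rightarrow> 'a::star_algebra set \<Rightarrow> 'a set \<Rightarrow> ('a \<Rightarrow> 'k \<Rightarrow>\<^sub>0 nat) \<Rightarrow> 'a set" where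
  "vanishing_projections K P T d = {p \<in> standard_projections P T.
     \<forall>x\<in>infinite_paths K T d. \<exists>n\<in>degs K. embed p * x n = 0}"

definition full_rel ::
  "'k set \<Rightarrow> 'a::star_algebra set \<Rightarrow> 'a set \<Rightarrow> ('a \<Rightarrow> 'k \<Rightarrow>\<^sub>0 nat) \<Rightarrow> ('a \<times> 'a) set" where
  "full_rel K P T d = {(a, b). a - b \<in> star_ideal UNIV hull vanishing_projections K P T d}"

text \<open>
  The quotient map onto the quotient by the ideal generated by the vanishing projections is a
  homomorphism, so it is an isomorphism iff it is bijective.
\<close>

definition full ::
  "'k set \<Rightarrow> 'a::star_algebra set \<Rightarrow> 'a set \<Rightarrow> ('a \<Rightarrow> 'k \<Rightarrow>\<^sub>0 nat) \<Rightarrow> bool" where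
  "full K P T d \<longleftrightarrow> bij_betw (Equiv_Relations.proj (full_rel K P T d)) UNIV (UNIV // full_rel K P T d)"

definition aperiodic ::
  "'a::star_algebra set \<Rightarrow> 'a set \<Rightarrow> ('a \<Rightarrow> 'k \<Rightarrow>\<^sub>0 nat) \<Rightarrow> bool" where
  "aperiodic P T d \<longleftrightarrow>
    (\<forall>e\<in>elementary_standard_projections P. \<forall>x\<in>T. x * e \<noteq> 0 \<longrightarrow>
      (\<forall>m n. m \<noteq> n \<and> m \<preceq> d x \<and> n \<preceq> d x \<longrightarrow>
        (\<exists>y\<in>T1 T. embed (x * e) * y \<noteq> 0 \<and>
          T1min T d (segment1 T d (embed x * y) m (deg1 d (embed x * y)))
                    (segment1 T d (embed x * y) n (deg1 d (embed x * y))) = {})))"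

end

theory Submission
  imports Defs
begin

text \<open>
  Let \<open>w = s r t\<^sup>\<star>\<close> be a standard word of nonzero degree, so that \<open>s\<close> and \<open>t\<close> have different
  degrees, and let \<open>p\<close> be a nonzero standard projection. Compressing \<open>w\<close> by a long path \<open>v\<close>
  cuts \<open>s\<close> and \<open>t\<close> off the front of \<open>v\<close>: the product \<open>s\<^sup>\<star> v\<close> is either zero or, up to a
  projection in \<open>P\<close>, the tail of \<open>v\<close> behind \<open>s\<close> (\<open>star_mult_long\<close>), and likewise for \<open>t\<close>.
  So \<open>v\<^sup>\<star> w v\<close> vanishes as soon as the tails of \<open>v\<close> behind the two different degrees have no
  common extension (\<open>compression_zero\<close>), and aperiodicity provides a \<open>v\<close> with that property.

  It remains to find such a \<open>v\<close> below \<open>p\<close>. In a full algebra some infinite path \<open>x\<close> has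
  \<open>p x\<^sub>n \<noteq> 0\<close> for all \<open>n\<close> (\<open>full_imp_nonvanishing_path\<close>). For \<open>n\<close> large and \<open>z = x\<^sub>n\<close> the
  standard projection \<open>p\<close> moves past \<open>z\<close> and becomes elementary, \<open>p z = z e\<close>
  (\<open>standard_projection_long\<close>). Aperiodicity, applied to \<open>z\<close>, \<open>e\<close> and the degrees of
  \<open>s\<close> and \<open>t\<close>, yields \<open>y\<close> with \<open>z e y \<noteq> 0\<close> for which \<open>v = z y\<close> has tails without a common
  extension. Writing \<open>e y = y e'\<close> with \<open>e'\<close> elementary, the projection
  \<open>q = v e' v\<^sup>\<star>\<close> is standard (\<open>conjugate_elementary\<close>), nonzero and below \<open>p\<close>, and \<open>q w q = 0\<close>.
\<close>

section \<open>Star-algebras and their unitizations\<close>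

lemma embed_mult: "embed (a * b) = embed a * embed b"
  for a b :: "'a::star_algebra"
  by (simp add: embed_def times_unitization_def)

lemma embed_star: "embed (a\<^sup>\<star>) = (embed a)\<^sup>\<star>"
  for a :: "'a::star_algebra"
  by (simp add: embed_def star_unitization_def)

lemma embed_0: "embed 0 = (0 :: 'a::star_algebra unitization)"
  by (simp add: embed_def zero_unitization_def)

lemma embed_eq_iff: "embed a = embed b \<longleftrightarrow> a = b"
  by (simp add: embed_def)

lemma embed_eq_0_iff: "embed a = 0 \<longleftrightarrow> a = 0"
  for a :: "'a::star_algebra"
  by (metis embed_0 embed_eq_iff)

lemma embed_neq_1: "embed a \<noteq> 1"
  for a :: "'a::star_algebra"
  by (simp add: embed_def one_unitization_def)

lemma alg_part_embed: "alg_part (embed a) = a"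
  by (simp add: embed_def)

lemma embed_mult_in_range: "\<exists>b. embed a * z = embed b"
  for a :: "'a::star_algebra"
  by (simp add: embed_def times_unitization_def)

lemma star_one_unitization: "1\<^sup>\<star> = (1 :: 'a::star_algebra unitization)"
  by (simp add: star_unitization_def one_unitization_def)

lemma star_minus: "(a - b)\<^sup>\<star> = a\<^sup>\<star> - b\<^sup>\<star>"
  for a b :: "'a::star_algebra"
  using star_add[of "a - b" b] by (simp add: algebra_simps)

lemma prod_list_commute:
  fixes c :: "'a::monoid_mult"
  assumes "\<And>r. r \<in> set rs \<Longrightarrow> c * r = r * c"
  shows "c * prod_list rs = prod_list rs * c"
  using assms
proof (induction rs)
  case (Cons r rs)
  then have "c * (r * prod_list rs) = r * (c * prod_list rs)"
    by (metis list.set_intros(1) mult.assoc)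
  with Cons show ?case by (simp add: mult.assoc)
qed simp

lemma prod_list_commuting_projections:
  fixes rs :: "'a::{ring_1,star_algebra} list"
  assumes "1\<^sup>\<star> = (1::'a)"
    and "\<And>r. r \<in> set rs \<Longrightarrow> is_projection r"
    and "\<And>r r'. r \<in> set rs \<Longrightarrow> r' \<in> set rs \<Longrightarrow> r * r' = r' * r"
  shows "is_projection (prod_list rs)"
  using assms(2,3)
proof (induction rs)
  case Nil
  then show ?case using assms(1) by (simp add: is_projection_def)
next
  case (Cons r rs)
  let ?p = "prod_list rs"
  have p: "?p * ?p = ?p" "?p\<^sup>\<star> = ?p" and r: "r * r = r" "r\<^sup>\<star> = r"
    using Cons by (auto simp: is_projection_def)
  have c: "r * ?p = ?p * r"
    by (rule prod_list_commute) (use Cons.prems in auto)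
  have "(r * ?p) * (r * ?p) = (r * r) * (?p * ?p)"
    using c by (metis mult.assoc)
  then show ?case
    using p r c by (simp add: is_projection_def star_mult)
qed

section \<open>Degrees\<close>

lemma degs_add: "m \<in> degs K \<Longrightarrow> n \<in> degs K \<Longrightarrow> m + n \<in> degs K"
  using Poly_Mapping.keys_add[of m n] by (auto simp: degs_def)

lemma zero_in_degs: "0 \<in> degs K"
  by (simp add: degs_def)

lemma deg_le_add_left: "m \<preceq> m + n" and deg_le_add_right: "n \<preceq> m + n"
  by (simp_all add: deg_le_def lookup_add)

lemma deg_le_refl: "m \<preceq> m"
  by (simp add: deg_le_def)

lemma deg_le_trans: "l \<preceq> m \<Longrightarrow> m \<preceq> n \<Longrightarrow> l \<preceq> n"
  by (auto simp: deg_le_def intro: order_trans)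

lemma deg_sup_absorb: "m \<preceq> n \<Longrightarrow> deg_sup m n = n" "n \<preceq> m \<Longrightarrow> deg_sup m n = m"
  by (auto simp: deg_le_def deg_sup.rep_eq max_def intro!: poly_mapping_eqI antisym)

lemma zero_deg_le: "0 \<preceq> n"
  by (simp add: deg_le_def)

lemma deg_add_eq_0: "m + n = 0 \<Longrightarrow> m = 0 \<and> n = (0 :: 'k \<Rightarrow>\<^sub>0 nat)"
  by (auto simp: poly_mapping_eq_iff plus_poly_mapping.rep_eq fun_eq_iff)

lemma int_deg_zero: "int_deg 0 = 0"
  by (rule poly_mapping_eqI) (simp add: int_deg_def map.rep_eq when_def)

section \<open>The unitized semigraph\<close>

context semigraph_algebra
begin

interpretation unital_k_semigraph K "T1 T" mul1 "deg1 d" 1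
  by (rule T_semigraph)

lemma one_in_T1: "1 \<in> T1 T"
  by (simp add: T1_def)

lemma embed_in_T1: "x \<in> T \<Longrightarrow> embed x \<in> T1 T"
  by (simp add: T1_def)

lemma deg1_one: "deg1 d 1 = 0"
  by (simp add: deg1_def)

lemma deg1_embed: "deg1 d (embed x) = d x"
  by (simp add: deg1_def embed_neq_1 alg_part_embed)

lemma deg1_mult:
  assumes "x \<in> T1 T" "y \<in> T1 T" "x * y \<noteq> 0"
  shows "deg1 d (x * y) = deg1 d x + deg1 d y"
  using degree_mul[of x y "x * y"] assms by (simp add: mul1_def)

lemma T1_nonzero: "x \<in> T1 T \<Longrightarrow> x \<noteq> 0"
  using T_partial_isometry by (auto simp: T1_def embed_eq_0_iff)

lemma T_mult_T1:
  assumes "x \<in> T" "y \<in> T1 T" "embed x * y \<noteq> 0"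
  obtains v where "v \<in> T" "embed x * y = embed v"
proof (cases "y = 1")
  case False
  then obtain z where "z \<in> T" "y = embed z" using assms(2) by (auto simp: T1_def)
  then show ?thesis
    using that[of "x * z"] assms T_mult by (simp add: embed_mult[symmetric] embed_eq_0_iff)
qed (use that assms in auto)

lemma T1_factor_unique:
  assumes "x \<in> T1 T" "y \<in> T1 T" "x' \<in> T1 T" "y' \<in> T1 T"
    and "x * y = v" "x' * y' = v" "v \<in> T1 T" "deg1 d x = deg1 d x'"
  shows "x = x' \<and> y = y'"
proof -
  have v: "v \<noteq> 0" using assms T1_nonzero by blast
  have d: "deg1 d v = deg1 d x + deg1 d y" "deg1 d v = deg1 d x' + deg1 d y'"
    using deg1_mult[OF assms(1,2)] deg1_mult[OF assms(3,4)] assms v by simp_all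
  then have "deg1 d y = deg1 d y'" using assms(8) by simp
  then have "(x, y) = (x', y')"
    using factorization[OF assms(7) d(1)] assms v
    by (elim ex1E) (metis fst_conv mul1_def snd_conv)
  then show ?thesis by simp
qed

text \<open>The factorizations \<open>1 * x\<close> and \<open>x * 1\<close> of an element of degree zero have the same degrees.\<close>

lemma deg1_eq_0:
  assumes "x \<in> T1 T" "deg1 d x = 0"
  shows "x = 1"
  using T1_factor_unique[of 1 x x 1 x] assms by (simp add: one_in_T1 deg1_one)

text \<open>
  The definition of a segment asks for three factors; for a tail the last one has degree zero.
\<close>

lemma segment1_tail:
  assumes "s \<in> T1 T" "\<alpha> \<in> T1 T" "v \<in> T1 T" "s * \<alpha> = v"
  shows "segment1 T d v (deg1 d s) (deg1 d v) = \<alpha>"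
proof -
  have nz: "v \<noteq> 0" using assms T1_nonzero by blast
  have dv: "deg1 d v = deg1 d s + deg1 d \<alpha>"
    using assms nz deg1_mult by blast
  show ?thesis
    unfolding segment_def
  proof (rule the_equality)
    show "\<alpha> \<in> T1 T \<and> (\<exists>x1\<in>T1 T. \<exists>x3\<in>T1 T.
        Option.bind (mul1 x1 \<alpha>) (\<lambda>y. mul1 y x3) = Some v \<and> deg1 d x1 = deg1 d s \<and>
        deg1 d \<alpha> = deg1 d v - deg1 d s \<and> deg1 d x3 = deg1 d v - deg1 d v)"
      using assms nz dv
      by (intro conjI bexI[of _ s] bexI[of _ 1]) (simp_all add: mul1_def deg1_one one_in_T1)
  next
    fix x2
    assume "x2 \<in> T1 T \<and> (\<exists>x1\<in>T1 T. \<exists>x3\<in>T1 T.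
        Option.bind (mul1 x1 x2) (\<lambda>y. mul1 y x3) = Some v \<and> deg1 d x1 = deg1 d s \<and>
        deg1 d x2 = deg1 d v - deg1 d s \<and> deg1 d x3 = deg1 d v - deg1 d v)"
    then obtain x1 x3 where x: "x1 \<in> T1 T" "x2 \<in> T1 T" "x3 \<in> T1 T"
      and eq: "Option.bind (mul1 x1 x2) (\<lambda>y. mul1 y x3) = Some v"
      and deg: "deg1 d x1 = deg1 d s" "deg1 d x3 = 0"
      by auto
    have "x3 = 1" using deg1_eq_0 x deg by blast
    then have "x1 * x2 = v"
      using eq by (auto simp: mul1_def split: if_splits)
    then show "x2 = \<alpha>"
      using T1_factor_unique[OF x(1,2) assms(1,2)] assms deg by blast
  qed
qed

section \<open>Moving elements past long paths\<close>

text \<open>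
  If \<open>v\<close> is at least as long as \<open>s\<close>, then a minimal common extension of \<open>s\<close> and \<open>v\<close> is \<open>v\<close>
  itself, so the sum expanding \<open>s\<^sup>\<star> v\<close> has at most one term, and in it \<open>\<beta> = 1\<close>.
\<close>

lemma star_mult_long_T:
  assumes "s \<in> T" "v \<in> T" "d s \<preceq> d v" "s\<^sup>\<star> * v \<noteq> 0"
  obtains \<alpha> q where "\<alpha> \<in> T1 T" "q \<in> P" "embed s * \<alpha> = embed v"
    "embed (s\<^sup>\<star> * v) = \<alpha> * embed q"
proof -
  let ?M = "T1min T d (embed s) (embed v)"
  obtain q where q: "\<And>\<alpha> \<beta>. (\<alpha>, \<beta>) \<in> ?M \<Longrightarrow> q \<alpha> \<beta> \<in> P"
    and sum: "embed (s\<^sup>\<star> * v) = (\<Sum>(\<alpha>, \<beta>) \<in> ?M. \<alpha> * embed (q \<alpha> \<beta>) * \<beta>\<^sup>\<star>)"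
    using star_mult_expand[OF assms(1,2)] by blast
  have M: "\<alpha> \<in> T1 T \<and> \<beta> = 1 \<and> embed s * \<alpha> = embed v" if "(\<alpha>, \<beta>) \<in> ?M" for \<alpha> \<beta>
  proof -
    have "embed v * \<beta> \<noteq> 0" and ab: "\<alpha> \<in> T1 T" "\<beta> \<in> T1 T" "embed s * \<alpha> = embed v * \<beta>"
      and "deg1 d (embed v * \<beta>) = d v"
      using that assms(3) by (auto simp: Tmin_def mul1_def deg1_embed deg_sup_absorb split: if_splits)
    then have "deg1 d \<beta> = 0"
      using deg1_mult[of "embed v" \<beta>] assms embed_in_T1 by (auto simp: deg1_embed)
    with ab show ?thesis using deg1_eq_0[of \<beta>] by auto
  qed
  have "embed (s\<^sup>\<star> * v) \<noteq> 0"
    using assms by (simp add: embed_eq_0_iff)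
  then have "?M \<noteq> {}"
    using sum by auto
  then obtain \<alpha> where \<alpha>: "(\<alpha>, 1) \<in> ?M"
    using M by fastforce
  have "\<alpha>' = \<alpha>" if "(\<alpha>', \<beta>) \<in> ?M" for \<alpha>' \<beta>
    using T1_factor_unique[of "embed s" \<alpha>' "embed s" \<alpha> "embed v"] M[OF that] M[OF \<alpha>]
      assms(1,2) embed_in_T1 by blast
  then have "?M = {(\<alpha>, 1)}"
    using \<alpha> M by fast
  then have "embed (s\<^sup>\<star> * v) = \<alpha> * embed (q \<alpha> 1)"
    using sum by (simp add: star_one_unitization)
  then show ?thesis
    using that M[OF \<alpha>] q[OF \<alpha>] by blast
qed

lemma T_star_cancel: "v \<in> T \<Longrightarrow> embed v * ((embed v)\<^sup>\<star> * embed v) = embed v"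
  using T_partial_isometry[of v]
  by (simp add: partial_isometry_def embed_mult[symmetric] embed_star[symmetric] mult.assoc)

lemma source_projection:
  assumes "v \<in> T"
  obtains q where "q \<in> P" "(embed v)\<^sup>\<star> * embed v = embed q"
proof -
  have "v\<^sup>\<star> * v \<noteq> 0"
    using T_partial_isometry[OF assms] by (auto simp: partial_isometry_def mult.assoc)
  then obtain \<alpha> q where *: "\<alpha> \<in> T1 T" "q \<in> P" "embed v * \<alpha> = embed v"
    "embed (v\<^sup>\<star> * v) = \<alpha> * embed q"
    using star_mult_long_T[OF assms assms deg_le_refl] by blast
  then have "\<alpha> = 1"
    using T1_factor_unique[of "embed v" \<alpha> "embed v" 1 "embed v"] assms embed_in_T1 one_in_T1
    by simp
  then show ?thesis
    using * that by (simp add: embed_mult embed_star)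
qed

text \<open>
  For \<open>s = 1\<close> the projection \<open>q\<close> is the source projection of \<open>v\<close>.
\<close>

lemma star_mult_long:
  assumes "s \<in> T1 T" "v \<in> T" "deg1 d s \<preceq> d v" "s\<^sup>\<star> * embed v \<noteq> 0"
  obtains \<alpha> q where "\<alpha> \<in> T1 T" "q \<in> P" "s * \<alpha> = embed v" "s\<^sup>\<star> * embed v = \<alpha> * embed q"
proof (cases "s = 1")
  case True
  obtain q where "q \<in> P" "(embed v)\<^sup>\<star> * embed v = embed q"
    using source_projection assms by blast
  then show ?thesis
    using that[of "embed v" q] True assms(2) T_star_cancel[of v] embed_in_T1
    by (simp add: star_one_unitization)
next
  case False
  then obtain s' where s': "s' \<in> T" "s = embed s'"
    using assms by (auto simp: T1_def)
  then have "s'\<^sup>\<star> * v \<noteq> 0"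
    using assms embed_eq_0_iff[of "s'\<^sup>\<star> * v"] by (simp add: embed_mult embed_star)
  then show ?thesis
    using star_mult_long_T[of s' v] s' assms that by (auto simp: deg1_embed embed_mult embed_star)
qed

lemma P_T1_commute:
  assumes "y \<in> T1 T" "p \<in> P"
  obtains q where "q \<in> P" "embed p * y = y * embed q"
proof (cases "y = 1")
  case False
  then obtain x where "x \<in> T" "y = embed x" using assms by (auto simp: T1_def)
  then show ?thesis using PT_commute[of x p] assms that by (metis embed_mult)
qed (use that assms in auto)

text \<open>
  For \<open>x = s p\<close> and a path \<open>v = s \<alpha>\<close>, the product \<open>s\<^sup>\<star> v\<close> is \<open>\<alpha>\<close> up to a projection on its
  right, and \<open>p\<close> moves past \<open>\<alpha>\<close>. The degree of \<open>s\<close> serves as \<open>N\<close>; it is hidden behind an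
  existential quantifier because \<open>x\<close> does not determine \<open>s\<close>.
\<close>

lemma half_standard_range_long:
  assumes "x \<in> half_standard_words P T"
  shows "\<exists>N\<in>degs K. \<forall>v\<in>T. N \<preceq> d v \<longrightarrow> embed (range_proj x) * embed v = 0 \<or>
    (\<exists>q\<in>P. embed (range_proj x) * embed v = embed v * embed q)"
proof -
  obtain s p where s: "s \<in> T1 T" and p: "p \<in> P" and x: "embed x = s * embed p"
    using assms by (auto simp: half_standard_words_def)
  have pp: "embed p * (embed p)\<^sup>\<star> = embed p"
    using P_projection[OF p] by (simp add: is_projection_def embed_mult[symmetric] embed_star[symmetric])
  have r: "embed (range_proj x) = s * (embed p * s\<^sup>\<star>)"
    using pp by (simp add: range_proj_def embed_mult embed_star x star_mult) (metis mult.assoc)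
  have "embed (range_proj x) * embed v = 0 \<or>
      (\<exists>q\<in>P. embed (range_proj x) * embed v = embed v * embed q)"
    if v: "v \<in> T" "deg1 d s \<preceq> d v" for v
  proof (cases "s\<^sup>\<star> * embed v = 0")
    case True
    then show ?thesis by (simp add: r mult.assoc)
  next
    case False
    then obtain \<alpha> q where \<alpha>: "\<alpha> \<in> T1 T" "q \<in> P" "s * \<alpha> = embed v" "s\<^sup>\<star> * embed v = \<alpha> * embed q"
      using star_mult_long s v by blast
    obtain q' where q': "q' \<in> P" "embed p * \<alpha> = \<alpha> * embed q'"
      using P_T1_commute \<alpha>(1) p by blast
    have "embed (range_proj x) * embed v = s * ((embed p * \<alpha>) * embed q)"
      by (simp add: r mult.assoc \<alpha>(4))
    also have "\<dots> = embed v * embed (q' * q)"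
      unfolding q'(2) by (simp add: mult.assoc embed_mult \<alpha>(3)[symmetric])
    finally show ?thesis
      using P_mult[OF q'(1) \<alpha>(2)] by blast
  qed
  then show ?thesis
    using degree_in[OF s] by blast
qed

text \<open>
  Taking adjoints of the whole product would reverse the order of its factors; moving
  \<open>v\<^sup>\<star>\<close> past one self-adjoint factor at a time keeps the order, so that both equations hold
  with the same list \<open>qs\<close>.
\<close>

lemma complement_list_commute:
  assumes "set ys \<subseteq> half_standard_words P T"
  shows "\<exists>N\<in>degs K. \<forall>v\<in>T. N \<preceq> d v \<longrightarrow> (\<exists>qs. set qs \<subseteq> P \<and>
    (\<Prod>y\<leftarrow>ys. 1 - embed (range_proj y)) * embed v = embed v * (\<Prod>q\<leftarrow>qs. 1 - embed q) \<and>
    (embed v)\<^sup>\<star> * (\<Prod>y\<leftarrow>ys. 1 - embed (range_proj y)) = (\<Prod>q\<leftarrow>qs. 1 - embed q) * (embed v)\<^sup>\<star>)"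
  using assms
proof (induction ys)
  case Nil
  then show ?case
    by (intro bexI[of _ 0] ballI impI exI[of _ "[]"]) (auto simp: zero_in_degs)
next
  case (Cons y ys)
  let ?R = "embed (range_proj y)" and ?Y = "\<Prod>y\<leftarrow>ys. 1 - embed (range_proj y)"
  obtain M where M: "M \<in> degs K" "\<And>v. v \<in> T \<Longrightarrow> M \<preceq> d v \<Longrightarrow> ?R * embed v = 0 \<or>
      (\<exists>q\<in>P. ?R * embed v = embed v * embed q)"
    using half_standard_range_long[of y] Cons.prems by auto
  obtain N where N: "N \<in> degs K" "\<And>v. v \<in> T \<Longrightarrow> N \<preceq> d v \<Longrightarrow> (\<exists>qs. set qs \<subseteq> P \<and>
    ?Y * embed v = embed v * (\<Prod>q\<leftarrow>qs. 1 - embed q) \<and>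
    (embed v)\<^sup>\<star> * ?Y = (\<Prod>q\<leftarrow>qs. 1 - embed q) * (embed v)\<^sup>\<star>)"
    using Cons by auto
  have Rstar: "?R\<^sup>\<star> = ?R"
    by (simp add: range_proj_def embed_mult embed_star star_mult star_star)
  have "\<exists>qs. set qs \<subseteq> P \<and>
    (1 - ?R) * ?Y * embed v = embed v * (\<Prod>q\<leftarrow>qs. 1 - embed q) \<and>
    (embed v)\<^sup>\<star> * ((1 - ?R) * ?Y) = (\<Prod>q\<leftarrow>qs. 1 - embed q) * (embed v)\<^sup>\<star>"
    if v: "v \<in> T" "M + N \<preceq> d v" for v
  proof -
    let ?v = "embed v"
    have "M \<preceq> d v" "N \<preceq> d v"
      using v deg_le_trans deg_le_add_left deg_le_add_right by blast+
    then obtain qs where qs: "set qs \<subseteq> P" "?Y * ?v = ?v * (\<Prod>q\<leftarrow>qs. 1 - embed q)"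
      "?v\<^sup>\<star> * ?Y = (\<Prod>q\<leftarrow>qs. 1 - embed q) * ?v\<^sup>\<star>"
      using N v by blast
    consider "?R * ?v = 0" | q where "q \<in> P" "?R * ?v = ?v * embed q"
      using M v \<open>M \<preceq> d v\<close> by blast
    then show ?thesis
    proof cases
      case 1
      then have "?v\<^sup>\<star> * ?R = 0"
        using Rstar by (metis star_mult star_zero)
      then have l: "?v\<^sup>\<star> * (1 - ?R) = ?v\<^sup>\<star>" and r: "(1 - ?R) * ?v = ?v"
        using 1 by (simp_all add: algebra_simps)
      have "(1 - ?R) * ?Y * ?v = ((1 - ?R) * ?v) * (\<Prod>q\<leftarrow>qs. 1 - embed q)"
        by (simp only: mult.assoc qs)
      moreover have "?v\<^sup>\<star> * ((1 - ?R) * ?Y) = (?v\<^sup>\<star> * (1 - ?R)) * ?Y"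
        by (simp only: mult.assoc)
      ultimately show ?thesis
        using qs l r by (intro exI[of _ qs]) simp
    next
      case 2
      have "(embed q)\<^sup>\<star> = embed q"
        using P_projection[OF 2(1)] by (simp add: is_projection_def embed_star[symmetric])
      then have "?v\<^sup>\<star> * ?R = embed q * ?v\<^sup>\<star>"
        using Rstar 2(2) by (metis star_mult)
      then have l: "?v\<^sup>\<star> * (1 - ?R) = (1 - embed q) * ?v\<^sup>\<star>" and r: "(1 - ?R) * ?v = ?v * (1 - embed q)"
        using 2 by (simp_all add: algebra_simps)
      have "(1 - ?R) * ?Y * ?v = ((1 - ?R) * ?v) * (\<Prod>q\<leftarrow>qs. 1 - embed q)"
        by (simp only: mult.assoc qs)
      moreover have "?v\<^sup>\<star> * ((1 - ?R) * ?Y) = (?v\<^sup>\<star> * (1 - ?R)) * ?Y"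
        by (simp only: mult.assoc)
      ultimately show ?thesis
        using qs 2(1) unfolding l r by (intro exI[of _ "q # qs"]) (simp add: mult.assoc)
    qed
  qed
  then show ?case
    using degs_add[OF M(1) N(1)] by (intro bexI[of _ "M + N"]) auto
qed

text \<open>
  The degree bound is the reason for following infinite paths: on all paths that are long
  enough, a standard projection acts as an elementary one placed on the other side.
\<close>

lemma standard_projection_long:
  assumes "p \<in> standard_projections P T"
  shows "\<exists>N\<in>degs K. \<forall>v\<in>T. N \<preceq> d v \<and> p * v \<noteq> 0 \<longrightarrow>
    (\<exists>e\<in>elementary_standard_projections P. p * v = v * e \<and> v\<^sup>\<star> * p = e * v\<^sup>\<star>)"
proof -
  obtain x ys where x: "x \<in> half_standard_words P T" and ys: "set ys \<subseteq> half_standard_words P T"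
    and p: "embed p = embed (range_proj x) * (\<Prod>y\<leftarrow>ys. 1 - embed (range_proj y))"
    using assms by (auto simp: standard_projections_def)
  let ?R = "embed (range_proj x)" and ?Y = "\<Prod>y\<leftarrow>ys. 1 - embed (range_proj y)"
  obtain M where M: "M \<in> degs K" "\<And>v. v \<in> T \<Longrightarrow> M \<preceq> d v \<Longrightarrow> ?R * embed v = 0 \<or>
      (\<exists>q\<in>P. ?R * embed v = embed v * embed q)"
    using half_standard_range_long[OF x] by auto
  obtain N where N: "N \<in> degs K" "\<And>v. v \<in> T \<Longrightarrow> N \<preceq> d v \<Longrightarrow> (\<exists>qs. set qs \<subseteq> P \<and>
    ?Y * embed v = embed v * (\<Prod>q\<leftarrow>qs. 1 - embed q) \<and>
    (embed v)\<^sup>\<star> * ?Y = (\<Prod>q\<leftarrow>qs. 1 - embed q) * (embed v)\<^sup>\<star>)"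
    using complement_list_commute[OF ys] by auto
  have Rstar: "?R\<^sup>\<star> = ?R"
    by (simp add: range_proj_def embed_mult embed_star star_mult star_star)
  have "\<exists>e\<in>elementary_standard_projections P. p * v = v * e \<and> v\<^sup>\<star> * p = e * v\<^sup>\<star>"
    if v: "v \<in> T" "M + N \<preceq> d v" "p * v \<noteq> 0" for v
  proof -
    let ?v = "embed v"
    have "M \<preceq> d v" "N \<preceq> d v"
      using v deg_le_trans deg_le_add_left deg_le_add_right by blast+
    then obtain qs where qs: "set qs \<subseteq> P" "?Y * ?v = ?v * (\<Prod>q\<leftarrow>qs. 1 - embed q)"
      "?v\<^sup>\<star> * ?Y = (\<Prod>q\<leftarrow>qs. 1 - embed q) * ?v\<^sup>\<star>"
      using N v by blast
    have pv: "embed p * ?v = (?R * ?v) * (\<Prod>q\<leftarrow>qs. 1 - embed q)"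
      by (simp only: p mult.assoc qs)
    moreover have "embed p * ?v \<noteq> 0"
      using v by (simp add: embed_mult[symmetric] embed_eq_0_iff)
    ultimately have "?R * ?v \<noteq> 0" by auto
    then obtain q where q: "q \<in> P" "?R * ?v = ?v * embed q"
      using M v \<open>M \<preceq> d v\<close> by blast
    have "(embed q)\<^sup>\<star> = embed q"
      using P_projection[OF q(1)] by (simp add: is_projection_def embed_star[symmetric])
    then have l: "?v\<^sup>\<star> * ?R = embed q * ?v\<^sup>\<star>"
      using Rstar q(2) by (metis star_mult)
    obtain e where e: "embed q * (\<Prod>q\<leftarrow>qs. 1 - embed q) = embed e"
      using embed_mult_in_range by blast
    have "?v\<^sup>\<star> * embed p = (?v\<^sup>\<star> * ?R) * ?Y"
      by (simp only: p mult.assoc)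
    also have "\<dots> = embed e * ?v\<^sup>\<star>"
      by (simp only: l mult.assoc qs e[symmetric])
    finally have "?v\<^sup>\<star> * embed p = embed e * ?v\<^sup>\<star>" .
    moreover have "embed p * ?v = ?v * embed e"
      by (simp only: pv q mult.assoc e)
    ultimately have "p * v = v * e" "v\<^sup>\<star> * p = e * v\<^sup>\<star>"
      by (metis embed_eq_iff embed_mult embed_star)+
    moreover have "e \<in> elementary_standard_projections P"
      using q(1) qs(1) e[symmetric] unfolding elementary_standard_projections_def by blast
    ultimately show ?thesis by blast
  qed
  then show ?thesis
    using degs_add[OF M(1) N(1)] by blast
qed

section \<open>Elementary standard projections\<close>

lemma P_embed_commute: "p \<in> P \<Longrightarrow> q \<in> P \<Longrightarrow> embed p * embed q = embed q * embed p"
  using P_commute by (metis embed_mult)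

lemma elementary_projection:
  assumes "e \<in> elementary_standard_projections P"
  shows "is_projection e" and "q \<in> P \<Longrightarrow> embed e * embed q = embed q * embed e"
proof -
  obtain p ps where p: "p \<in> P" "set ps \<subseteq> P" and e: "embed e = embed p * (\<Prod>q\<leftarrow>ps. 1 - embed q)"
    using assms by (auto simp: elementary_standard_projections_def)
  let ?rs = "embed p # map (\<lambda>q. 1 - embed q) ps"
  have eq: "embed e = prod_list ?rs"
    using e by simp
  have proj: "is_projection (embed q)" if "q \<in> P" for q
    using P_projection[OF that] by (simp add: is_projection_def embed_mult[symmetric] embed_star[symmetric])
  have "is_projection (1 - embed q)" if "q \<in> P" for q
    using proj[OF that] by (simp add: is_projection_def star_minus star_one_unitization algebra_simps)
  then have "is_projection (prod_list ?rs)"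
    using p proj
    by (intro prod_list_commuting_projections)
      (auto simp: star_one_unitization algebra_simps subset_iff P_embed_commute)
  then show "is_projection e"
    unfolding eq[symmetric]
    by (simp add: is_projection_def embed_mult[symmetric] embed_star[symmetric] embed_eq_iff)
  show "embed e * embed q = embed q * embed e" if "q \<in> P"
    unfolding eq
    by (rule prod_list_commute[symmetric]) (use p that in \<open>auto simp: algebra_simps subset_iff P_embed_commute\<close>)
qed

lemma elementary_T1_commute:
  assumes "e \<in> elementary_standard_projections P" "y \<in> T1 T"
  obtains e' where "e' \<in> elementary_standard_projections P" "embed e * y = y * embed e'"
proof -
  obtain p ps where p: "p \<in> P" "set ps \<subseteq> P" and e: "embed e = embed p * (\<Prod>q\<leftarrow>ps. 1 - embed q)"
    using assms by (auto simp: elementary_standard_projections_def)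
  have "\<exists>qs. set qs \<subseteq> P \<and> (\<Prod>q\<leftarrow>ps. 1 - embed q) * y = y * (\<Prod>q\<leftarrow>qs. 1 - embed q)"
    using p(2)
  proof (induction ps)
    case Nil
    then show ?case by (intro exI[of _ "[]"]) simp
  next
    case (Cons r ps)
    then obtain qs where qs: "set qs \<subseteq> P"
      "(\<Prod>q\<leftarrow>ps. 1 - embed q) * y = y * (\<Prod>q\<leftarrow>qs. 1 - embed q)" by auto
    obtain r' where r': "r' \<in> P" "embed r * y = y * embed r'"
      using P_T1_commute assms Cons.prems by (metis list.set_intros(1) subsetD)
    then have "(1 - embed r) * y = y * (1 - embed r')" by (simp add: algebra_simps)
    then have "(\<Prod>q\<leftarrow>r # ps. 1 - embed q) * y = y * (\<Prod>q\<leftarrow>r' # qs. 1 - embed q)"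
      using qs(2) by simp (metis mult.assoc)
    then show ?case
      using qs(1) r'(1) by (intro exI[of _ "r' # qs"]) simp
  qed
  then obtain qs where qs: "set qs \<subseteq> P"
    "(\<Prod>q\<leftarrow>ps. 1 - embed q) * y = y * (\<Prod>q\<leftarrow>qs. 1 - embed q)" by blast
  obtain q where q: "q \<in> P" "embed p * y = y * embed q"
    using P_T1_commute assms p by blast
  obtain e' where e': "embed q * (\<Prod>q\<leftarrow>qs. 1 - embed q) = embed e'"
    using embed_mult_in_range by blast
  have "embed e * y = y * embed e'"
    unfolding e e'[symmetric] using qs(2) q(2) by (metis mult.assoc)
  moreover have "e' \<in> elementary_standard_projections P"
    using q(1) qs(1) e'[symmetric] unfolding elementary_standard_projections_def by blast
  ultimately show ?thesis using that by blast
qed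

text \<open>
  Conjugation by \<open>v\<close> is multiplicative on \<open>P\<close> because the source projection
  \<open>v\<^sup>\<star> v\<close> lies in \<open>P\<close>, hence commutes with \<open>P\<close> and is absorbed by \<open>v\<^sup>\<star>\<close>.
\<close>

lemma conjugate_elementary:
  assumes v: "v \<in> T" and e: "e \<in> elementary_standard_projections P"
  shows "v * e * v\<^sup>\<star> \<in> standard_projections P T"
proof -
  obtain p ps where p: "p \<in> P" "set ps \<subseteq> P" and eq: "embed e = embed p * (\<Prod>q\<leftarrow>ps. 1 - embed q)"
    using e by (auto simp: elementary_standard_projections_def)
  let ?v = "embed v"
  obtain q where q: "q \<in> P" "?v\<^sup>\<star> * ?v = embed q"
    using source_projection v by blast
  have qv: "embed q * ?v\<^sup>\<star> = ?v\<^sup>\<star>"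
    using T_star_cancel[OF v] q P_projection[OF q(1)]
    by (metis embed_star is_projection_def star_mult)
  have rp: "embed (range_proj (v * r)) = ?v * embed r * ?v\<^sup>\<star>" if "r \<in> P" for r
    using P_projection[OF that]
    by (simp add: range_proj_def star_mult is_projection_def mult.assoc embed_mult[symmetric] embed_star[symmetric])
      (metis mult.assoc)
  have step: "?v * c * ?v\<^sup>\<star> * (1 - embed (range_proj (v * r))) = ?v * (c * (1 - embed r)) * ?v\<^sup>\<star>"
    if "r \<in> P" for r c
  proof -
    have "?v * c * ?v\<^sup>\<star> * (?v * embed r * ?v\<^sup>\<star>) = ?v * c * ((?v\<^sup>\<star> * ?v) * embed r) * ?v\<^sup>\<star>"
      by (simp only: mult.assoc)
    also have "\<dots> = ?v * c * (embed r * embed q) * ?v\<^sup>\<star>"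
      unfolding q(2) using P_embed_commute[OF q(1) that] by simp
    also have "\<dots> = ?v * (c * embed r) * ?v\<^sup>\<star>"
      by (simp only: mult.assoc qv)
    finally show ?thesis
      unfolding rp[OF that] by (simp add: algebra_simps)
  qed
  have "?v * c * ?v\<^sup>\<star> * (\<Prod>y\<leftarrow>map ((*) v) ps. 1 - embed (range_proj y)) =
      ?v * (c * (\<Prod>q\<leftarrow>ps. 1 - embed q)) * ?v\<^sup>\<star>" for c
    using p(2)
  proof (induction ps arbitrary: c)
    case (Cons r ps)
    have "?v * c * ?v\<^sup>\<star> * (\<Prod>y\<leftarrow>map ((*) v) (r # ps). 1 - embed (range_proj y)) =
      ?v * c * ?v\<^sup>\<star> * (1 - embed (range_proj (v * r))) * (\<Prod>y\<leftarrow>map ((*) v) ps. 1 - embed (range_proj y))"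
      by (simp add: mult.assoc)
    also have "\<dots> = ?v * ((c * (1 - embed r)) * (\<Prod>q\<leftarrow>ps. 1 - embed q)) * ?v\<^sup>\<star>"
      using Cons step[of r] by simp
    finally show ?case
      by (simp add: mult.assoc)
  qed simp
  from this[of "embed p"]
  have "embed (v * e * v\<^sup>\<star>) = embed (range_proj (v * p)) *
      (\<Prod>y\<leftarrow>map ((*) v) ps. 1 - embed (range_proj y))"
    by (simp only: rp[OF p(1)] embed_mult embed_star eq)
  moreover have "v * r \<in> half_standard_words P T" if "r \<in> P" for r
    using that v embed_in_T1 by (auto simp: half_standard_words_def embed_mult)
  ultimately show ?thesis
    using p unfolding standard_projections_def
    by (intro CollectI exI[of _ "v * p"] exI[of _ "map ((*) v) ps"]) auto
qed

section \<open>Cancellation\<close>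

lemma degree_of_standard_word:
  assumes "s \<in> T1 T" "p \<in> P" "t \<in> T1 T" "embed w = s * embed p * t\<^sup>\<star>" "w \<noteq> 0"
  shows "degree_of P T d w = int_deg (deg1 d s) - int_deg (deg1 d t)"
proof -
  \<comment> \<open>The unit is not a letter, so it is represented by the empty list.\<close>
  define ls where "ls = (if s = 1 then [] else [Gen (alg_part s)])"
  define lt where "lt = (if t = 1 then [] else [Gen_star (alg_part t)])"
  let ?w = "Word (ls @ [Gen p] @ lt)"
  have s: "prod_list (map (\<lambda>l. embed (letter_val l)) ls) = s"
    and ds: "(\<Sum>l\<leftarrow>ls. letter_deg T d l) = int_deg (deg1 d s)"
    using assms(1) by (auto simp: ls_def T1_def alg_part_embed embed_neq_1 deg1_embed deg1_one gen_deg_def int_deg_zero)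
  have t: "prod_list (map (\<lambda>l. embed (letter_val l)) lt) = t\<^sup>\<star>"
    and dt: "(\<Sum>l\<leftarrow>lt. letter_deg T d l) = - int_deg (deg1 d t)"
    using assms(3) by (auto simp: lt_def T1_def alg_part_embed embed_neq_1 deg1_embed deg1_one
        gen_deg_def int_deg_zero embed_star star_one_unitization)
  have "word_val ?w = w"
    using assms(4) by (simp add: word_val_def s t mult.assoc[symmetric] flip: assms(4)) (simp add: alg_part_embed)
  moreover have "?w \<in> words (T \<union> P)"
    using assms by (auto simp: words_def zero_word_def ls_def lt_def T1_def alg_part_embed)
  moreover have "word_deg T d ?w = int_deg (deg1 d s) - int_deg (deg1 d t)"
    using disjoint assms(2) by (auto simp: word_deg_def ds dt gen_deg_def)
  ultimately show ?thesis
    using degree_of_word_val assms(5) by metis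
qed

text \<open>Fullness makes the ideal generated by the vanishing projections trivial.\<close>

lemma full_imp_nonvanishing_path:
  assumes "full K P T d" "p \<in> standard_projections P T" "p \<noteq> 0"
  obtains x where "x \<in> infinite_paths K T d" "\<And>n. n \<in> degs K \<Longrightarrow> embed p * x n \<noteq> 0"
proof -
  let ?I = "star_ideal UNIV hull vanishing_projections K P T d"
  have ideal: "star_ideal UNIV ?I"
    by (rule star_ideal_hull) (auto simp: star_ideal_def)
  have "p \<notin> vanishing_projections K P T d"
  proof
    assume "p \<in> vanishing_projections K P T d"
    then have p: "p \<in> ?I" by (rule hull_inc)
    have add: "a + b \<in> ?I" and neg: "- a \<in> ?I" if "a \<in> ?I" "b \<in> ?I" for a b
    proof -
      show "a + b \<in> ?I" using ideal that unfolding star_ideal_def by blast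
      have "(- 1) *\<^sub>C a \<in> ?I" using ideal that unfolding star_ideal_def by blast
      moreover have "(- 1) *\<^sub>C a + 1 *\<^sub>C a = 0" using scaleC_add_left[of "- 1" 1 a] by simp
      then have "- a = (- 1) *\<^sub>C a" by (metis scaleC_one add.commute minus_unique)
      ultimately show "- a \<in> ?I" by simp
    qed
    have "full_rel K P T d `` {p} = full_rel K P T d `` {0}"
    proof -
      have "p - b \<in> ?I \<longleftrightarrow> - b \<in> ?I" for b
        using add[of p "- b"] add[of "- p" "p - b"] neg[OF p p] p by auto
      then show ?thesis by (auto simp: full_rel_def)
    qed
    then have "p = 0"
      using assms(1) unfolding full_def bij_betw_def Equiv_Relations.proj_def by (auto dest: injD)
    then show False using assms by simp
  qed
  then show ?thesis
    using assms that unfolding vanishing_projections_def by blast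
qed

text \<open>
  A set of minimal common extensions with an argument \<open>1\<close> is never empty. So \<open>\<alpha>\<close> and \<open>\<beta>\<close> lie in
  the semigraph itself, where the product expands into an empty sum.
\<close>

lemma disjoint_star_mult:
  assumes "\<alpha> \<in> T1 T" "\<beta> \<in> T1 T" "T1min T d \<alpha> \<beta> = {}"
  shows "\<alpha>\<^sup>\<star> * \<beta> = 0"
proof -
  have "(\<beta>, 1) \<in> T1min T d \<alpha> \<beta>" if "\<alpha> = 1"
    using that assms T1_nonzero one_in_T1 by (auto simp: Tmin_def mul1_def deg1_one deg_sup_absorb zero_deg_le)
  moreover have "(1, \<alpha>) \<in> T1min T d \<alpha> \<beta>" if "\<beta> = 1"
    using that assms T1_nonzero one_in_T1 by (auto simp: Tmin_def mul1_def deg1_one deg_sup_absorb zero_deg_le)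
  ultimately obtain a b where "a \<in> T" "b \<in> T" "\<alpha> = embed a" "\<beta> = embed b"
    using assms by (auto simp: T1_def)
  then show ?thesis
    using star_mult_expand[of a b] assms(3) by (auto simp: embed_mult embed_star)
qed

text \<open>
  Compressing \<open>s r t\<^sup>\<star>\<close> to \<open>v\<close> replaces \<open>s\<close> and \<open>t\<close> by the tails of \<open>v\<close> behind them,
  and these have no common extension.
\<close>

lemma compression_zero:
  assumes s: "s \<in> T1 T" and r: "r \<in> P" and t: "t \<in> T1 T" and v: "v \<in> T"
    and le: "deg1 d s \<preceq> d v" "deg1 d t \<preceq> d v"
    and disj: "T1min T d (segment1 T d (embed v) (deg1 d s) (d v))
      (segment1 T d (embed v) (deg1 d t) (d v)) = {}"
  shows "(embed v)\<^sup>\<star> * (s * embed r * t\<^sup>\<star>) * embed v = 0"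
proof (cases "s\<^sup>\<star> * embed v = 0 \<or> t\<^sup>\<star> * embed v = 0")
  case True
  then have "(embed v)\<^sup>\<star> * s = 0 \<or> t\<^sup>\<star> * embed v = 0"
    by (metis star_mult star_star star_zero)
  moreover have "(embed v)\<^sup>\<star> * (s * embed r * t\<^sup>\<star>) * embed v =
      ((embed v)\<^sup>\<star> * s) * embed r * (t\<^sup>\<star> * embed v)"
    by (simp only: mult.assoc)
  ultimately show ?thesis by auto
next
  case False
  obtain \<alpha> q where \<alpha>: "\<alpha> \<in> T1 T" "s * \<alpha> = embed v" "s\<^sup>\<star> * embed v = \<alpha> * embed q"
    using star_mult_long[OF s v le(1)] False by metis
  obtain \<beta> q' where \<beta>: "\<beta> \<in> T1 T" "t * \<beta> = embed v" "t\<^sup>\<star> * embed v = \<beta> * embed q'"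
    using star_mult_long[OF t v le(2)] False by metis
  have "T1min T d \<alpha> \<beta> = {}"
    using disj segment1_tail[OF s \<alpha>(1) embed_in_T1[OF v] \<alpha>(2)]
      segment1_tail[OF t \<beta>(1) embed_in_T1[OF v] \<beta>(2)] by (simp add: deg1_embed)
  then have z: "\<alpha>\<^sup>\<star> * \<beta> = 0"
    using disjoint_star_mult \<alpha> \<beta> by blast
  obtain r' where r': "embed r * \<beta> = \<beta> * embed r'"
    using P_T1_commute \<beta>(1) r by blast
  have "(embed v)\<^sup>\<star> * s = (\<alpha> * embed q)\<^sup>\<star>"
    using \<alpha>(3) by (metis star_mult star_star)
  then have l: "(embed v)\<^sup>\<star> * s = (embed q)\<^sup>\<star> * \<alpha>\<^sup>\<star>"
    by (simp add: star_mult)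
  have "(embed v)\<^sup>\<star> * (s * embed r * t\<^sup>\<star>) * embed v =
      ((embed v)\<^sup>\<star> * s) * embed r * (t\<^sup>\<star> * embed v)"
    by (simp only: mult.assoc)
  also have "\<dots> = (embed q)\<^sup>\<star> * \<alpha>\<^sup>\<star> * (embed r * \<beta>) * embed q'"
    unfolding l \<beta>(3) by (simp only: mult.assoc)
  also have "\<dots> = (embed q)\<^sup>\<star> * (\<alpha>\<^sup>\<star> * \<beta>) * embed r' * embed q'"
    unfolding r' by (simp only: mult.assoc)
  finally show ?thesis using z by simp
qed

lemma aperiodic_full_imp_cancelling:
  assumes ap: "aperiodic P T d" and full: "full K P T d"
  shows "cancelling P T d"
  unfolding cancelling_def
proof (intro ballI impI)
  fix w p
  assume w: "w \<in> standard_words P T" and wd: "w \<noteq> 0 \<and> degree_of P T d w \<noteq> 0"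
    and p: "p \<in> standard_projections P T" and p0: "p \<noteq> 0"
  obtain s r t where s: "s \<in> T1 T" and r: "r \<in> P" and t: "t \<in> T1 T" and w_eq: "embed w = s * embed r * t\<^sup>\<star>"
    using w by (auto simp: standard_words_def)
  have ne: "deg1 d s \<noteq> deg1 d t"
    using degree_of_standard_word[OF s r t w_eq] wd by auto
  obtain N where N: "N \<in> degs K" "\<And>v. v \<in> T \<Longrightarrow> N \<preceq> d v \<Longrightarrow> p * v \<noteq> 0 \<Longrightarrow>
      \<exists>e\<in>elementary_standard_projections P. p * v = v * e \<and> v\<^sup>\<star> * p = e * v\<^sup>\<star>"
    using standard_projection_long[OF p] by blast
  obtain x where x: "x \<in> infinite_paths K T d" "\<And>n. n \<in> degs K \<Longrightarrow> embed p * x n \<noteq> 0"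
    using full_imp_nonvanishing_path[OF full p p0] by blast
  \<comment> \<open>A sum of degrees is an upper bound for all of them; it is nonzero, so that \<open>x n \<noteq> 1\<close>.\<close>
  define n where "n = deg1 d s + (deg1 d t + N)"
  have n: "n \<in> degs K"
    unfolding n_def by (intro degs_add degree_in s t N)
  have le: "deg1 d s \<preceq> n" "deg1 d t \<preceq> n" "N \<preceq> n"
    by (simp_all add: n_def deg_le_def lookup_add)
  have "n \<noteq> 0"
    using ne deg_add_eq_0 unfolding n_def by metis
  then obtain z where z: "z \<in> T" "x n = embed z" "d z = n"
    using x(1) n by (auto simp: infinite_paths_def T1_def deg1_one deg1_embed)
  have "p * z \<noteq> 0"
    using x(2)[OF n] z(2) by (simp add: embed_mult[symmetric] embed_eq_0_iff)
  then obtain e where e: "e \<in> elementary_standard_projections P" "p * z = z * e" "z\<^sup>\<star> * p = e * z\<^sup>\<star>"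
    using N z le by blast
  have "z * e \<noteq> 0" using e \<open>p * z \<noteq> 0\<close> by simp
  then obtain y where y: "y \<in> T1 T" "embed (z * e) * y \<noteq> 0"
    and disj: "T1min T d (segment1 T d (embed z * y) (deg1 d s) (deg1 d (embed z * y)))
      (segment1 T d (embed z * y) (deg1 d t) (deg1 d (embed z * y))) = {}"
    using ap e(1) z le ne unfolding aperiodic_def by blast
  obtain e' where e': "e' \<in> elementary_standard_projections P" "embed e * y = y * embed e'"
    using elementary_T1_commute[OF e(1) y(1)] by blast
  have zy: "embed (z * e) * y = embed z * y * embed e'"
    using e'(2) by (simp add: embed_mult mult.assoc)
  then have "embed z * y \<noteq> 0"
    using y(2) by auto
  then obtain v where v: "v \<in> T" "embed z * y = embed v"
    using T_mult_T1[OF z(1) y(1)] by blast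
  have ve: "v * e' \<noteq> 0"
    using y(2) zy v(2) by (metis embed_0 embed_mult)
  have "d v = n + deg1 d y"
    using deg1_mult[of "embed z" y] z v y embed_in_T1 \<open>embed z * y \<noteq> 0\<close> by (simp add: deg1_embed)
  then have lev: "deg1 d s \<preceq> d v" "deg1 d t \<preceq> d v"
    using le deg_le_trans deg_le_add_left by metis+
  have "(embed v)\<^sup>\<star> * (s * embed r * t\<^sup>\<star>) * embed v = 0"
    using compression_zero[OF s r t v(1) lev] disj v(2) by (simp add: deg1_embed)
  then have vwv: "v\<^sup>\<star> * w * v = 0"
    by (simp add: w_eq[symmetric] embed_star[symmetric] embed_mult[symmetric] embed_eq_0_iff)
  have idem: "e' * e' = e'" "e'\<^sup>\<star> = e'" "e\<^sup>\<star> = e"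
    using elementary_projection(1) e(1) e'(1) by (auto simp: is_projection_def)
  let ?q = "v * e' * v\<^sup>\<star>"
  have "?q \<in> standard_projections P T"
    by (rule conjugate_elementary[OF v(1) e'(1)])
  moreover have "?q \<noteq> 0"
  proof
    assume q0: "?q = 0"
    \<comment> \<open>\<open>q v = v e' v\<^sup>\<star> v = v v\<^sup>\<star> v e' = v e'\<close>, as \<open>e'\<close> commutes with the source projection of \<open>v\<close>.\<close>
    obtain u where u: "u \<in> P" "(embed v)\<^sup>\<star> * embed v = embed u"
      using source_projection v by blast
    have "embed (v * e') = embed v * embed u * embed e'"
      using T_star_cancel[OF v(1)] u(2) by (simp add: embed_mult)
    also have "\<dots> = embed v * embed e' * ((embed v)\<^sup>\<star> * embed v)"
      using elementary_projection(2)[OF e'(1) u(1)] u(2) by (simp add: mult.assoc)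
    also have "\<dots> = embed (?q * v)"
      by (simp add: embed_mult embed_star mult.assoc)
    finally show False
      using q0 ve by (simp add: embed_eq_iff)
  qed
  moreover have "?q * p = ?q"
  proof -
    have "y\<^sup>\<star> * embed e = embed e' * y\<^sup>\<star>"
      using e'(2) idem by (metis embed_star star_mult)
    moreover have "(embed v)\<^sup>\<star> * embed p = y\<^sup>\<star> * (embed e * (embed z)\<^sup>\<star>)"
      using e(3) v(2)[symmetric] by (simp add: star_mult mult.assoc embed_star[symmetric] embed_mult[symmetric])
    ultimately have "(embed v)\<^sup>\<star> * embed p = embed e' * (embed v)\<^sup>\<star>"
      using v(2) by (metis mult.assoc star_mult)
    then have "v\<^sup>\<star> * p = e' * v\<^sup>\<star>"
      by (simp add: embed_star[symmetric] embed_mult[symmetric] embed_eq_iff)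
    then have "?q * p = v * (e' * e') * v\<^sup>\<star>"
      by (simp add: mult.assoc)
    then show ?thesis by (simp add: idem)
  qed
  moreover have "?q * w * ?q = 0"
  proof -
    have "?q * w * ?q = v * e' * (v\<^sup>\<star> * w * v) * e' * v\<^sup>\<star>"
      by (simp only: mult.assoc)
    then show ?thesis by (simp add: vwv)
  qed
  ultimately show "\<exists>q\<in>standard_projections P T. q \<noteq> 0 \<and> q * p = q \<and> q * w * q = 0"
    by blast
qed

end

theorem proposition9p6:
  fixes K :: "'k set" and P T :: "'a::star_algebra set" and d :: "'a \<Rightarrow> 'k \<Rightarrow>\<^sub>0 nat"
  assumes "semigraph_algebra K P T d"
    and "aperiodic P T d"
    and "full K P T d"
  shows "cancelling P T d"
  using semigraph_algebra.aperiodic_full_imp_cancelling[OF assms] .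

end
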